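(* Let $P$ be a projection algebra, let $S$ be any projection-generated regular $*$-semigroup with $P=\mathsf P(S)$, and let $p_0\in P$ be arbitrary. Let $D$ be the $\mathscr D$-class of $S$ containing $p_0$, let $P_D=P\cap D$, let $E_D$ be the set of idempotents of $S$ lying in $D$, and let $T$ be any spanning tree for the Graham--Houghton graph $\mathsf{GH}(D)$, identified with a subset of $E_D$, such that $P_D\subseteq T$. Then the maximal subgroup of $\mathsf{PG}(P)$ containing $x_{p_0}$ is defined by the group presentation with generators $\{a_e: e\in E_D\}$ and relations \begin{align*} &a_e=1 && \text{for all } e\in T,\\ &a_e=a_{e^*}^{-1} && \text{for all } e\in E_D,\\ &a_e^{-1}a_f=a_g^{-1}a_h && \text{for all singular squares } \begin{pmatrix} e & f \\ g & h \end{pmatrix} \text{ of idempotents in } D. \end{align*}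
   Context: A regular $*$-semigroup is a semigroup $S$ with a unary operation $a\mapsto a^*$ satisfying $(a^* )^*=a=aa^*a$ and $(ab)^*=b^*a^*$. A projection is an element $p$ with $p^2=p=p^*$; $\mathsf P(S)$ is the set of projections, and for $p,q\in \mathsf P(S)$ one has $pqp\in \mathsf P(S)$. The set $P=\mathsf P(S)$ with the unary operations $q\mapsto pqp$ ($p\in P$) is the projection algebra of $S$; every (abstract) projection algebra is of this form. $S$ is projection-generated if it is generated as a semigroup by $\mathsf P(S)$. $\mathsf{PG}(P)$ is the semigroup defined by the semigroup presentation with generators $x_p$ ($p\in P$) and relations $x_p^2=x_p$, $(x_px_q)^2=x_px_q$, $x_px_qx_p=x_{pqp}$ ($p,q\in P$). The maximal subgroup containing the idempotent $x_{p_0}$ is its $\mathscr H$-class in $\mathsf{PG}(P)$. The Graham--Houghton graph $\mathsf{GH}(D)$ is the bipartite graph whose vertex set is the disjoint union of the set of $\mathscr R$-classes in $D$ and the set of $\mathscr L$-classes in $D$, with an edge joining an $\mathscr R$-class $R$ and an $\mathscr L$-class $L$ iff $R\cap L$ is a group, equivalently contains an idempotent; this edge is identified with that (unique) idempotent, so edge sets are subsets of $E_D$. A square of idempotents is an array $\begin{pmatrix} e & f \\ g & h \end{pmatrix}$ of (not necessarily distinct) idempotents of $S$ with $e\,\mathscr R\,f$, $g\,\mathscr R\,h$, $e\,\mathscr L\,g$, $f\,\mathscr L\,h$. It is LR-singularised by an idempotent $u$ of $S$ if $ue=e$, $ug=g$, $eu=f$, $gu=h$, and UD-singularised by $u$ if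 $eu=e$, $fu=f$, $ue=g$, $uf=h$. It is RL-singularised (resp. DU-singularised) by $u$ if the square obtained by swapping its columns (resp. rows) is LR-singularised (resp. UD-singularised) by $u$. It is a singular square if it is LR-, RL-, UD- or DU-singularised by some idempotent $u$ of $S$. *)

theory Defs
  imports "HOL-Algebra.Group"
begin

section \<open>Semigroups and regular star-semigroups\<close>

record 'a sgrp = "'a partial_object" +
  sprod :: "'a \<Rightarrow> 'a \<Rightarrow> 'a" (infixl "\<cdot>\<index>" 70)

record 'a star_sgrp = "'a sgrp" +
  star :: "'a \<Rightarrow> 'a"

locale regular_star_semigroup =
  fixes S :: "('a, 'm) star_sgrp_scheme" (structure)
  assumes prod_closed: "\<lbrakk>a \<in> carrier S; b \<in> carrier S\<rbrakk> \<Longrightarrow> a \<cdot> b \<in> carrier S"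
    and prod_assoc: "\<lbrakk>a \<in> carrier S; b \<in> carrier S; c \<in> carrier S\<rbrakk>
                       \<Longrightarrow> (a \<cdot> b) \<cdot> c = a \<cdot> (b \<cdot> c)"
    and star_closed: "a \<in> carrier S \<Longrightarrow> star S a \<in> carrier S"
    and star_star: "a \<in> carrier S \<Longrightarrow> star S (star S a) = a"
    and prod_star_prod: "a \<in> carrier S \<Longrightarrow> a \<cdot> star S a \<cdot> a = a"
    and star_prod: "\<lbrakk>a \<in> carrier S; b \<in> carrier S\<rbrakk>
                      \<Longrightarrow> star S (a \<cdot> b) = star S b \<cdot> star S a"

definition idempotents :: "('a, 'm) sgrp_scheme \<Rightarrow> 'a set" where
  "idempotents S = {e \<in> carrier S. e \<cdot>\<^bsub>S\<^esub> e = e}"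

definition projections :: "('a, 'm) star_sgrp_scheme \<Rightarrow> 'a set" where
  "projections S = {p \<in> carrier S. p \<cdot>\<^bsub>S\<^esub> p = p \<and> star S p = p}"

inductive_set subsemigroup_generated :: "('a, 'm) sgrp_scheme \<Rightarrow> 'a set \<Rightarrow> 'a set"
  for S :: "('a, 'm) sgrp_scheme" and X :: "'a set" where
  incl: "x \<in> X \<Longrightarrow> x \<in> subsemigroup_generated S X"
| prod: "\<lbrakk>a \<in> subsemigroup_generated S X; b \<in> subsemigroup_generated S X\<rbrakk>
           \<Longrightarrow> a \<cdot>\<^bsub>S\<^esub> b \<in> subsemigroup_generated S X"

definition projection_generated :: "('a, 'm) star_sgrp_scheme \<Rightarrow> bool" where
  "projection_generated S \<longleftrightarrow> carrier S = subsemigroup_generated S (projections S)"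


section \<open>Green's relations\<close>

text \<open>The principal one-sided ideals \<open>a S\<^sup>1\<close> and \<open>S\<^sup>1 a\<close>.\<close>

definition right_ideal :: "('a, 'm) sgrp_scheme \<Rightarrow> 'a \<Rightarrow> 'a set" where
  "right_ideal S a = insert a {a \<cdot>\<^bsub>S\<^esub> s |s. s \<in> carrier S}"

definition left_ideal :: "('a, 'm) sgrp_scheme \<Rightarrow> 'a \<Rightarrow> 'a set" where
  "left_ideal S a = insert a {s \<cdot>\<^bsub>S\<^esub> a |s. s \<in> carrier S}"

definition greenR :: "('a, 'm) sgrp_scheme \<Rightarrow> 'a rel" where
  "greenR S = {(a, b). a \<in> carrier S \<and> b \<in> carrier S \<and> right_ideal S a = right_ideal S b}"

definition greenL :: "('a, 'm) sgrp_scheme \<Rightarrow> 'a rel" where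
  "greenL S = {(a, b). a \<in> carrier S \<and> b \<in> carrier S \<and> left_ideal S a = left_ideal S b}"

definition greenH :: "('a, 'm) sgrp_scheme \<Rightarrow> 'a rel" where
  "greenH S = greenR S \<inter> greenL S"

text \<open>The join of \<open>greenR S\<close> and \<open>greenL S\<close> in the lattice of equivalence relations on the
  carrier.\<close>

definition greenD :: "('a, 'm) sgrp_scheme \<Rightarrow> 'a rel" where
  "greenD S = (greenR S \<union> greenL S)\<^sup>+"

definition maximal_subgroup :: "('a, 'm) sgrp_scheme \<Rightarrow> 'a \<Rightarrow> 'a monoid" where
  "maximal_subgroup S e =
     \<lparr>carrier = greenH S `` {e}, monoid.mult = sprod S, one = e\<rparr>"


section \<open>Semigroup and group presentations\<close>

inductive_set word_cong :: "('x list \<times> 'x list) set \<Rightarrow> 'x list rel"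
  for Rels :: "('x list \<times> 'x list) set" where
  rel: "(u, v) \<in> Rels \<Longrightarrow> (x @ u @ y, x @ v @ y) \<in> word_cong Rels"
| refl: "(w, w) \<in> word_cong Rels"
| sym: "(u, v) \<in> word_cong Rels \<Longrightarrow> (v, u) \<in> word_cong Rels"
| trans: "\<lbrakk>(u, v) \<in> word_cong Rels; (v, w) \<in> word_cong Rels\<rbrakk> \<Longrightarrow> (u, w) \<in> word_cong Rels"

definition class_prod ::
  "('x list \<times> 'x list) set \<Rightarrow> 'x list set \<Rightarrow> 'x list set \<Rightarrow> 'x list set" where
  "class_prod Rels X Y = (\<Union>u\<in>X. \<Union>v\<in>Y. word_cong Rels `` {u @ v})"

definition semigroup_presentation ::
  "'x set \<Rightarrow> ('x list \<times> 'x list) set \<Rightarrow> 'x list set sgrp" where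
  "semigroup_presentation X Rels =
     \<lparr>carrier = (lists X - {[]}) // word_cong Rels, sprod = class_prod Rels\<rparr>"

text \<open>Group words over \<open>X\<close> are lists of pairs: \<open>(x, True)\<close> is the letter \<open>x\<close>, and
  \<open>(x, False)\<close> is its formal inverse.\<close>

definition cancellation_rels :: "'x set \<Rightarrow> (('x \<times> bool) list \<times> ('x \<times> bool) list) set" where
  "cancellation_rels X = {([(x, b), (x, \<not> b)], []) |x b. x \<in> X}"

definition group_presentation ::
  "'x set \<Rightarrow> (('x \<times> bool) list \<times> ('x \<times> bool) list) set \<Rightarrow> ('x \<times> bool) list set monoid" where
  "group_presentation X Rels =
     (let C = Rels \<union> cancellation_rels X in
      \<lparr>carrier = lists (X \<times> UNIV) // word_cong C,
       monoid.mult = class_prod C,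
       one = word_cong C `` {[]}\<rparr>)"


section \<open>Projection algebras and the semigroup PG(P)\<close>

text \<open>The unary operation indexed by \<open>p\<close> is \<open>proj_op P p\<close>.\<close>

record 'a proj_alg = "'a partial_object" +
  proj_op :: "'a \<Rightarrow> 'a \<Rightarrow> 'a"

definition is_projection_algebra_of ::
  "('a, 'n) proj_alg_scheme \<Rightarrow> ('a, 'm) star_sgrp_scheme \<Rightarrow> bool" where
  "is_projection_algebra_of P S \<longleftrightarrow>
     carrier P = projections S \<and>
     (\<forall>p \<in> carrier P. \<forall>q \<in> carrier P. proj_op P p q = p \<cdot>\<^bsub>S\<^esub> q \<cdot>\<^bsub>S\<^esub> p)"

definition PG_rels :: "('a, 'n) proj_alg_scheme \<Rightarrow> ('a list \<times> 'a list) set" where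
  "PG_rels P =
     {([p, p], [p]) |p. p \<in> carrier P} \<union>
     {([p, q, p, q], [p, q]) |p q. p \<in> carrier P \<and> q \<in> carrier P} \<union>
     {([p, q, p], [proj_op P p q]) |p q. p \<in> carrier P \<and> q \<in> carrier P}"

definition PG :: "('a, 'n) proj_alg_scheme \<Rightarrow> 'a list set sgrp" where
  "PG P = semigroup_presentation (carrier P) (PG_rels P)"

definition PG_gen :: "('a, 'n) proj_alg_scheme \<Rightarrow> 'a \<Rightarrow> 'a list set" where
  "PG_gen P p = word_cong (PG_rels P) `` {[p]}"


section \<open>Spanning trees and Graham--Houghton graphs\<close>

text \<open>Undirected simple graphs, possibly infinite: a vertex set \<open>V\<close> and a set \<open>F\<close> of
  two-element subsets of \<open>V\<close>.\<close>

definition is_walk :: "'v set set \<Rightarrow> 'v list \<Rightarrow> bool" where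
  "is_walk F vs \<longleftrightarrow> vs \<noteq> [] \<and> successively (\<lambda>u v. {u, v} \<in> F) vs"

definition is_connected :: "'v set \<Rightarrow> 'v set set \<Rightarrow> bool" where
  "is_connected V F \<longleftrightarrow>
     V \<noteq> {} \<and> (\<forall>u \<in> V. \<forall>v \<in> V. \<exists>vs. is_walk F vs \<and> hd vs = u \<and> last vs = v)"

definition is_cycle :: "'v set set \<Rightarrow> 'v list \<Rightarrow> bool" where
  "is_cycle F vs \<longleftrightarrow>
     length vs \<ge> 3 \<and> distinct vs \<and> is_walk F vs \<and> {last vs, hd vs} \<in> F"

definition is_tree :: "'v set \<Rightarrow> 'v set set \<Rightarrow> bool" where
  "is_tree V F \<longleftrightarrow> is_connected V F \<and> (\<nexists>vs. is_cycle F vs)"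

definition is_spanning_tree :: "'v set \<Rightarrow> 'v set set \<Rightarrow> 'v set set \<Rightarrow> bool" where
  "is_spanning_tree V F F' \<longleftrightarrow> F' \<subseteq> F \<and> is_tree V F'"

definition GH_verts :: "('a, 'm) sgrp_scheme \<Rightarrow> 'a set \<Rightarrow> ('a set + 'a set) set" where
  "GH_verts S D = (D // greenR S) <+> (D // greenL S)"

definition GH_edges :: "('a, 'm) sgrp_scheme \<Rightarrow> 'a set \<Rightarrow> ('a set + 'a set) set set" where
  "GH_edges S D =
     {{Inl R, Inr L} |R L. R \<in> D // greenR S \<and> L \<in> D // greenL S \<and>
                           R \<inter> L \<inter> idempotents S \<noteq> {}}"

text \<open>The edge identified with an idempotent \<open>e\<close>. As an \<open>H\<close>-class contains at most one
  idempotent, this is a bijection from the idempotents of \<open>D\<close> onto \<open>GH_edges S D\<close>.\<close>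

definition GH_edge :: "('a, 'm) sgrp_scheme \<Rightarrow> 'a \<Rightarrow> ('a set + 'a set) set" where
  "GH_edge S e = {Inl (greenR S `` {e}), Inr (greenL S `` {e})}"

definition GH_spanning_tree :: "('a, 'm) sgrp_scheme \<Rightarrow> 'a set \<Rightarrow> 'a set \<Rightarrow> bool" where
  "GH_spanning_tree S D T \<longleftrightarrow>
     T \<subseteq> idempotents S \<inter> D \<and>
     is_spanning_tree (GH_verts S D) (GH_edges S D) (GH_edge S ` T)"


section \<open>Singular squares\<close>

text \<open>The arguments \<open>e f g h\<close> list the entries of the array row by row: \<open>e f\<close> is the top
  row and \<open>g h\<close> is the bottom row.\<close>

definition is_square :: "('a, 'm) sgrp_scheme \<Rightarrow> 'a \<Rightarrow> 'a \<Rightarrow> 'a \<Rightarrow> 'a \<Rightarrow> bool" where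
  "is_square S e f g h \<longleftrightarrow>
     {e, f, g, h} \<subseteq> idempotents S \<and>
     (e, f) \<in> greenR S \<and> (g, h) \<in> greenR S \<and> (e, g) \<in> greenL S \<and> (f, h) \<in> greenL S"

definition LR_singularised ::
  "('a, 'm) sgrp_scheme \<Rightarrow> 'a \<Rightarrow> 'a \<Rightarrow> 'a \<Rightarrow> 'a \<Rightarrow> 'a \<Rightarrow> bool" where
  "LR_singularised S e f g h u \<longleftrightarrow>
     u \<cdot>\<^bsub>S\<^esub> e = e \<and> u \<cdot>\<^bsub>S\<^esub> g = g \<and> e \<cdot>\<^bsub>S\<^esub> u = f \<and> g \<cdot>\<^bsub>S\<^esub> u = h"

definition UD_singularised ::
  "('a, 'm) sgrp_scheme \<Rightarrow> 'a \<Rightarrow> 'a \<Rightarrow> 'a \<Rightarrow> 'a \<Rightarrow> 'a \<Rightarrow> bool" where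
  "UD_singularised S e f g h u \<longleftrightarrow>
     e \<cdot>\<^bsub>S\<^esub> u = e \<and> f \<cdot>\<^bsub>S\<^esub> u = f \<and> u \<cdot>\<^bsub>S\<^esub> e = g \<and> u \<cdot>\<^bsub>S\<^esub> f = h"

definition RL_singularised ::
  "('a, 'm) sgrp_scheme \<Rightarrow> 'a \<Rightarrow> 'a \<Rightarrow> 'a \<Rightarrow> 'a \<Rightarrow> 'a \<Rightarrow> bool" where
  "RL_singularised S e f g h u \<longleftrightarrow> LR_singularised S f e h g u"

definition DU_singularised ::
  "('a, 'm) sgrp_scheme \<Rightarrow> 'a \<Rightarrow> 'a \<Rightarrow> 'a \<Rightarrow> 'a \<Rightarrow> 'a \<Rightarrow> bool" where
  "DU_singularised S e f g h u \<longleftrightarrow> UD_singularised S g h e f u"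

definition singular_square :: "('a, 'm) sgrp_scheme \<Rightarrow> 'a \<Rightarrow> 'a \<Rightarrow> 'a \<Rightarrow> 'a \<Rightarrow> bool" where
  "singular_square S e f g h \<longleftrightarrow>
     is_square S e f g h \<and>
     (\<exists>u \<in> idempotents S.
        LR_singularised S e f g h u \<or> RL_singularised S e f g h u \<or>
        UD_singularised S e f g h u \<or> DU_singularised S e f g h u)"

definition subgroup_rels ::
  "('a, 'm) star_sgrp_scheme \<Rightarrow> 'a set \<Rightarrow> 'a set
     \<Rightarrow> (('a \<times> bool) list \<times> ('a \<times> bool) list) set" where
  "subgroup_rels S D T =
     {([(e, True)], []) |e. e \<in> T} \<union>
     {([(e, True)], [(star S e, False)]) |e. e \<in> idempotents S \<inter> D} \<union>
     {([(e, False), (f, True)], [(g, False), (h, True)]) |e f g h.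
        singular_square S e f g h \<and> {e, f, g, h} \<subseteq> D}"

end

theory Submission
  imports Defs
begin

text \<open>The words over \<open>P\<close> form, modulo the defining relations of \<open>PG(P)\<close>, a regular
  \<open>*\<close>-semigroup under reversal of words, and \<open>w w\<^sup>*\<close> and \<open>w\<^sup>* w\<close> are always equivalent to a single
  letter. So the \<open>\<H>\<close>-class of a word is a morphism of a groupoid with object set \<open>P\<close>, and the
  maximal subgroup is the vertex group at \<open>p\<^sub>0\<close>. A morphism factors as a path through the
  \<open>\<L>\<close>-classes of its prefixes, each step of which is an idempotent of \<open>D\<close>; replacing the steps
  by the generators \<open>a\<^sub>e\<close> gives a map to the presented group. Three consecutive steps for
  \<open>x\<^sub>p x\<^sub>q x\<^sub>p\<close> collapse to the step for \<open>x\<^bsub>pqp\<^esub>\<close> by means of two squares that are UD-singularised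
  by \<open>p\<close>. In the other direction, \<open>a\<^sub>e\<close> is sent to the loop that runs along the tree \<open>T\<close> from \<open>p\<^sub>0\<close>
  to the source of \<open>e\<close>, then along \<open>e\<close>, and back along \<open>T\<close>. Singular squares are respected
  because the idempotents of \<open>PG(P)\<close> are determined by their images in \<open>S\<close>.\<close>

section \<open>Word congruences\<close>

lemma word_cong_context:
  assumes "(u, v) \<in> word_cong Rels"
  shows "(x @ u @ y, x @ v @ y) \<in> word_cong Rels"
  using assms
proof induction
  case (rel u v a b)
  then have "((x @ a) @ u @ (b @ y), (x @ a) @ v @ (b @ y)) \<in> word_cong Rels"
    by (rule word_cong.rel)
  then show ?case by simp
qed (auto intro: word_cong.intros)

lemma word_cong_append:
  assumes "(u, u') \<in> word_cong Rels" and "(v, v') \<in> word_cong Rels"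
  shows "(u @ v, u' @ v') \<in> word_cong Rels"
  using word_cong_context[OF assms(1), of "[]" v] word_cong_context[OF assms(2), of u' "[]"]
  by (auto intro: word_cong.trans)

lemma word_cong_base: "(u, v) \<in> Rels \<Longrightarrow> (u, v) \<in> word_cong Rels"
  using word_cong.rel[of u v Rels "[]" "[]"] by simp

lemma word_cong_class_eq_iff:
  "word_cong Rels `` {u} = word_cong Rels `` {v} \<longleftrightarrow> (u, v) \<in> word_cong Rels"
  by (auto intro: word_cong.intros)

lemma class_prod_class:
  "class_prod Rels (word_cong Rels `` {u}) (word_cong Rels `` {v}) = word_cong Rels `` {u @ v}"
  unfolding class_prod_def
  by (auto intro: word_cong.intros word_cong_append)

text \<open>\<open>word_cong\<close> relates lists over the whole type, so staying inside the
  alphabet has to be carried along as an invariant of the relations.\<close>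

lemma word_cong_lists:
  assumes "(u, v) \<in> word_cong Rels"
    and "\<And>u v. (u, v) \<in> Rels \<Longrightarrow> u \<in> lists X \<longleftrightarrow> v \<in> lists X"
  shows "u \<in> lists X \<longleftrightarrow> v \<in> lists X"
  using assms(1) by induction (use assms(2) in auto)

lemma word_cong_Nil_iff:
  assumes "(u, v) \<in> word_cong Rels"
    and "\<And>u v. (u, v) \<in> Rels \<Longrightarrow> u = [] \<longleftrightarrow> v = []"
  shows "u = [] \<longleftrightarrow> v = []"
  using assms(1) by induction (use assms(2) in auto)

section \<open>Paths in trees\<close>

text \<open>Strip the common initial vertices; where the paths part, they enclose a cycle up to a
  vertex at which they meet again.\<close>

lemma acyclic_path_unique:
  assumes "\<nexists>vs. is_cycle F vs"
    and "is_walk F vs" "is_walk F ws" "distinct vs" "distinct ws"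
    and "hd vs = hd ws" "last vs = last ws"
  shows "vs = ws"
  using assms(2-)
proof (induction vs arbitrary: ws)
  case Nil
  then show ?case by (simp add: is_walk_def)
next
  case (Cons a vs)
  from Cons.prems obtain ws'' where ws: "ws = a # ws''"
    by (cases ws) (auto simp: is_walk_def)
  show ?case
  proof (cases vs)
    case Nil
    then show ?thesis using Cons.prems ws by (cases ws'') (auto split: if_splits)
  next
    case vs: (Cons b vs')
    \<comment> \<open>Otherwise the second path is \<open>[a]\<close>, so \<open>vs\<close> would
      end at \<open>a\<close>, which distinctness forbids.\<close>
    have ne: "ws'' \<noteq> []"
      using Cons.prems vs ws by (metis distinct.simps(2) last_ConsL last_ConsR last_in_set list.distinct(1))
    then obtain c ws' where ws2: "ws'' = c # ws'" by (cases ws'') auto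
    show ?thesis
    proof (cases "b = c")
      case True
      have "vs = ws''"
        using Cons.prems vs ws ws2 True by (intro Cons.IH) (auto simp: is_walk_def)
      then show ?thesis using ws by simp
    next
      case False
      have "\<exists>x\<in>set vs. x \<in> set ws''"
        using Cons.prems vs ws ne by (metis last_ConsR last_in_set list.distinct(1))
      then obtain xs y ys where sp: "vs = xs @ y # ys" "y \<in> set ws''" "\<forall>x\<in>set xs. x \<notin> set ws''"
        by (rule split_list_first_propE)
      obtain ws1 ws2' where sp2: "ws'' = ws1 @ y # ws2'"
        using sp(2) by (meson split_list)
      \<comment> \<open>Out along the first path up to \<open>y\<close>, its first vertex on the
        other path, and back along the other path. The choice of \<open>y\<close> keeps the two
        halves disjoint.\<close>
      let ?cyc = "(a # xs @ [y]) @ rev ws1"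
      have sucF: "successively (\<lambda>u v. {u, v} \<in> F) (a # xs @ y # ys)"
        "successively (\<lambda>u v. {u, v} \<in> F) (a # ws1 @ y # ws2')"
        using Cons.prems ws sp(1) sp2 by (auto simp: is_walk_def)
      have s1: "successively (\<lambda>u v. {u, v} \<in> F) (a # xs @ [y])"
        using sucF(1) by (auto simp: successively_append_iff successively_Cons hd_append)
      have s2: "successively (\<lambda>u v. {u, v} \<in> F) (ws1 @ [y])"
        using sucF(2) by (auto simp: successively_append_iff successively_Cons hd_append)
      have s3: "successively (\<lambda>u v. {u, v} \<in> F) (y # rev ws1)"
      proof -
        have "successively (\<lambda>u v. {v, u} \<in> F) (ws1 @ [y])"
          using s2 by (simp add: insert_commute)
        then have "successively (\<lambda>u v. {u, v} \<in> F) (rev (ws1 @ [y]))"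
          by (subst successively_rev)
        then show ?thesis by simp
      qed
      have walk: "is_walk F ?cyc"
        using s1 s3 unfolding is_walk_def
        by (auto simp: successively_append_iff successively_Cons hd_append)
      have dist: "distinct ?cyc"
        using Cons.prems ws sp sp2 by auto
      have edge: "{last ?cyc, hd ?cyc} \<in> F"
        using sucF(2) by (cases ws1) (auto simp: insert_commute)
      \<comment> \<open>As \<open>b \<noteq> c\<close>, the segments \<open>xs\<close> and
        \<open>ws1\<close> are not both empty, which gives a third vertex besides \<open>a\<close>
        and \<open>y\<close>.\<close>
      have len: "length ?cyc \<ge> 3"
        using False vs sp sp2 ws2 by (cases xs; cases ws1) auto
      have "is_cycle F ?cyc"
        using walk dist edge len unfolding is_cycle_def by blast
      then show ?thesis using assms(1) by blast
    qed
  qed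
qed

text \<open>Cutting out the closed piece between two visits to the same vertex shortens the
  walk.\<close>

lemma walk_imp_path:
  assumes "is_walk F vs"
  shows "\<exists>ws. is_walk F ws \<and> distinct ws \<and> hd ws = hd vs \<and> last ws = last vs"
  using assms
proof (induction vs rule: length_induct)
  case (1 vs)
  show ?case
  proof (cases "distinct vs")
    case False
    then obtain xs y ys zs where vs: "vs = xs @ [y] @ ys @ [y] @ zs"
      using not_distinct_decomp by blast
    let ?ws = "xs @ [y] @ zs"
    have "is_walk F ?ws"
      using "1.prems" unfolding vs is_walk_def
      by (auto simp: successively_append_iff successively_Cons)
    moreover have "length ?ws < length vs" "hd ?ws = hd vs" "last ?ws = last vs"
      by (auto simp: vs hd_append)
    ultimately show ?thesis using "1.IH" by metis
  qed (use 1 in blast)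
qed

text \<open>\<open>\<pi> v\<close> is the unique path from the root. For an edge, either
  \<open>v\<close> is off the path to \<open>u\<close> and extends it, or the part of that path from
  \<open>v\<close> to \<open>u\<close> is, by uniqueness, the edge itself.\<close>

lemma tree_paths:
  assumes "is_tree V F" and "r \<in> V"
  obtains \<pi> where "\<pi> r = [r]"
    and "\<And>v. v \<in> V \<Longrightarrow> is_walk F (\<pi> v) \<and> hd (\<pi> v) = r \<and> last (\<pi> v) = v"
    and "\<And>u v. \<lbrakk>u \<in> V; v \<in> V; u \<noteq> v; {u, v} \<in> F\<rbrakk> \<Longrightarrow> \<pi> v = \<pi> u @ [v] \<or> \<pi> u = \<pi> v @ [u]"
proof -
  have acyc: "\<nexists>vs. is_cycle F vs" using assms(1) by (simp add: is_tree_def)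
  define good where "good v vs \<longleftrightarrow> is_walk F vs \<and> distinct vs \<and> hd vs = r \<and> last vs = v" for v vs
  define \<pi> where "\<pi> v = (SOME vs. good v vs)" for v
  have ex: "\<exists>vs. good v vs" if "v \<in> V" for v
    using assms that walk_imp_path unfolding is_tree_def is_connected_def good_def by metis
  have good: "good v (\<pi> v)" if "v \<in> V" for v
    unfolding \<pi>_def using ex[OF that] by (rule someI_ex)
  have uniq: "vs = \<pi> v" if "good v vs" "v \<in> V" for v vs
    using that good[OF that(2)] acyclic_path_unique[OF acyc] unfolding good_def by metis
  show ?thesis
  proof
    show "\<pi> r = [r]"
      using uniq[of r "[r]"] assms(2) by (simp add: good_def is_walk_def)
    show "is_walk F (\<pi> v) \<and> hd (\<pi> v) = r \<and> last (\<pi> v) = v" if "v \<in> V" for v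
      using good[OF that] by (simp add: good_def)
    fix u v assume uv: "u \<in> V" "v \<in> V" "u \<noteq> v" "{u, v} \<in> F"
    note gu = good[OF uv(1)]
    show "\<pi> v = \<pi> u @ [v] \<or> \<pi> u = \<pi> v @ [u]"
    proof (cases "v \<in> set (\<pi> u)")
      case False
      then have "good v (\<pi> u @ [v])"
        using gu uv(4) by (auto simp: good_def is_walk_def successively_append_iff)
      then show ?thesis using uniq uv(2) by metis
    next
      case True
      then obtain xs ys where sp: "\<pi> u = xs @ v # ys" by (meson split_list)
      have "good v (xs @ [v])"
        using gu unfolding good_def is_walk_def sp
        by (auto simp: successively_append_iff successively_Cons hd_append)
      then have 1: "xs @ [v] = \<pi> v" using uniq uv(2) by blast
      have "is_walk F (v # ys)" "distinct (v # ys)" "last (v # ys) = u"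
        using gu unfolding good_def is_walk_def sp by (auto simp: successively_append_iff)
      moreover have "is_walk F [v, u]" using uv(4) by (simp add: is_walk_def insert_commute)
      ultimately have "v # ys = [v, u]"
        using uv(3) by (intro acyclic_path_unique[OF acyc]) auto
      then show ?thesis using sp 1 by auto
    qed
  qed
qed

section \<open>Green's relations and projections\<close>

context regular_star_semigroup
begin

lemmas star_simps = prod_closed star_closed star_star star_prod prod_assoc

lemma prod_star_prod': "a \<in> carrier S \<Longrightarrow> a \<cdot> (star S a \<cdot> a) = a"
  using prod_star_prod[of a] by (simp add: star_simps)

lemma prod_star_prod_left:
  assumes "a \<in> carrier S" "x \<in> carrier S"
  shows "a \<cdot> (star S a \<cdot> (a \<cdot> x)) = a \<cdot> x"
  using arg_cong[OF prod_star_prod[OF assms(1)], of "\<lambda>y. y \<cdot> x"] assms by (simp add: star_simps)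

lemma star_prod_star: "a \<in> carrier S \<Longrightarrow> star S a \<cdot> (a \<cdot> star S a) = star S a"
  using prod_star_prod'[of "star S a"] by (simp add: star_simps)

lemma star_prod_star_left:
  assumes "a \<in> carrier S" "x \<in> carrier S"
  shows "star S a \<cdot> (a \<cdot> (star S a \<cdot> x)) = star S a \<cdot> x"
  using prod_star_prod_left[of "star S a" x] assms by (simp add: star_simps)

lemma projD:
  assumes "p \<in> projections S"
  shows "p \<in> carrier S" "p \<cdot> p = p" "star S p = p"
    and "x \<in> carrier S \<Longrightarrow> p \<cdot> (p \<cdot> x) = p \<cdot> x"
  using assms prod_assoc[of p p x] by (auto simp: projections_def)

lemma projI: "\<lbrakk>p \<in> carrier S; p \<cdot> p = p; star S p = p\<rbrakk> \<Longrightarrow> p \<in> projections S"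
  by (simp add: projections_def)

lemma prod_star_proj: "a \<in> carrier S \<Longrightarrow> a \<cdot> star S a \<in> projections S"
  by (rule projI) (simp_all add: star_simps star_prod_star)

lemma star_prod_proj: "a \<in> carrier S \<Longrightarrow> star S a \<cdot> a \<in> projections S"
  using prod_star_proj[of "star S a"] by (simp add: star_simps)

lemma proj_comm_iff:
  assumes "p \<in> projections S" "q \<in> projections S"
  shows "p \<cdot> q = q \<longleftrightarrow> q \<cdot> p = q"
  using assms by (metis projD(1,3) star_prod)

lemma proj_conj:
  assumes "p \<in> projections S" "q \<in> projections S"
  shows "p \<cdot> (q \<cdot> p) \<in> projections S"
proof -
  note [simp] = assms[THEN projD(1)] assms[THEN projD(2)] assms[THEN projD(3)]
    assms[THEN projD(4)] star_simps
  have "p \<cdot> q \<cdot> star S (p \<cdot> q) \<in> projections S" by (intro prod_star_proj) simp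
  then show ?thesis by simp
qed

text \<open>This is \<open>a \<cdot> star S a \<cdot> a = a\<close> for
  \<open>a = p \<cdot> q\<close>. The form with a trailing \<open>x\<close> rewrites inside
  right-nested products.\<close>

lemma proj_prod_idem:
  assumes "p \<in> projections S" "q \<in> projections S"
  shows "p \<cdot> (q \<cdot> (p \<cdot> q)) = p \<cdot> q"
    and "x \<in> carrier S \<Longrightarrow> p \<cdot> (q \<cdot> (p \<cdot> (q \<cdot> x))) = p \<cdot> (q \<cdot> x)"
proof -
  note [simp] = assms[THEN projD(1)] assms[THEN projD(2)] assms[THEN projD(3)]
    assms[THEN projD(4)] star_simps
  show "p \<cdot> (q \<cdot> (p \<cdot> q)) = p \<cdot> q"
    using prod_star_prod[of "p \<cdot> q"] by simp
  from arg_cong[OF this, of "\<lambda>y. y \<cdot> x"]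
  show "x \<in> carrier S \<Longrightarrow> p \<cdot> (q \<cdot> (p \<cdot> (q \<cdot> x))) = p \<cdot> (q \<cdot> x)" by simp
qed

text \<open>The projection \<open>a \<cdot> star S a\<close> labels the \<R>-class of
  \<open>a\<close>. Elements with the same right ideal have projections that absorb each other, and
  such projections agree because the star reverses products.\<close>

lemma greenR_iff:
  "(a, b) \<in> greenR S \<longleftrightarrow> a \<in> carrier S \<and> b \<in> carrier S \<and> a \<cdot> star S a = b \<cdot> star S b"
proof safe
  assume ab: "(a, b) \<in> greenR S"
  then show c: "a \<in> carrier S" "b \<in> carrier S" by (auto simp: greenR_def)
  have fix_left: "y \<cdot> star S y \<cdot> x = x"
    if "x \<in> right_ideal S y" "x \<in> carrier S" "y \<in> carrier S" for x y
    using that by (auto simp: right_ideal_def star_simps prod_star_prod' prod_star_prod_left)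
  have "a \<in> right_ideal S b" "b \<in> right_ideal S a"
    using ab unfolding greenR_def by (auto simp: right_ideal_def)
  then have eq: "b \<cdot> star S b \<cdot> a = a" "a \<cdot> star S a \<cdot> b = b"
    using fix_left c by auto
  let ?p = "a \<cdot> star S a" and ?q = "b \<cdot> star S b"
  have "?q \<cdot> ?p = ?p" "?p \<cdot> ?q = ?q"
    using arg_cong[OF eq(1), of "\<lambda>x. x \<cdot> star S a"] arg_cong[OF eq(2), of "\<lambda>x. x \<cdot> star S b"] c
    by (simp_all add: star_simps)
  then show "?p = ?q"
    using proj_comm_iff[OF prod_star_proj prod_star_proj] c by metis
next
  assume c: "a \<in> carrier S" "b \<in> carrier S" and eq: "a \<cdot> star S a = b \<cdot> star S b"
  have sub: "right_ideal S x \<subseteq> right_ideal S y"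
    if x: "x \<in> carrier S" "y \<in> carrier S" and e: "x \<cdot> star S x = y \<cdot> star S y" for x y
  proof -
    have xy: "x = y \<cdot> (star S y \<cdot> x)"
      using arg_cong[OF e, of "\<lambda>z. z \<cdot> x"] x by (simp add: star_simps prod_star_prod')
    have "x \<cdot> s = y \<cdot> (star S y \<cdot> x \<cdot> s)" if "s \<in> carrier S" for s
      using arg_cong[OF xy, of "\<lambda>z. z \<cdot> s"] x that by (simp add: star_simps)
    moreover have "star S y \<cdot> x \<in> carrier S" "\<And>s. s \<in> carrier S \<Longrightarrow> star S y \<cdot> x \<cdot> s \<in> carrier S"
      using x by (simp_all add: star_simps)
    ultimately show ?thesis using xy unfolding right_ideal_def by blast
  qed
  show "(a, b) \<in> greenR S"
    using sub[OF c eq] sub[OF c(2,1) eq[symmetric]] c by (auto simp: greenR_def)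
qed

lemma greenL_iff:
  "(a, b) \<in> greenL S \<longleftrightarrow> a \<in> carrier S \<and> b \<in> carrier S \<and> star S a \<cdot> a = star S b \<cdot> b"
proof safe
  assume ab: "(a, b) \<in> greenL S"
  then show c: "a \<in> carrier S" "b \<in> carrier S" by (auto simp: greenL_def)
  have fix_right: "x \<cdot> (star S y \<cdot> y) = x"
    if "x \<in> left_ideal S y" "x \<in> carrier S" "y \<in> carrier S" for x y
    using that by (auto simp: left_ideal_def star_simps prod_star_prod')
  have "a \<in> left_ideal S b" "b \<in> left_ideal S a"
    using ab unfolding greenL_def by (auto simp: left_ideal_def)
  then have eq: "a \<cdot> (star S b \<cdot> b) = a" "b \<cdot> (star S a \<cdot> a) = b"
    using fix_right c by auto
  let ?p = "star S a \<cdot> a" and ?q = "star S b \<cdot> b"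
  have "?p \<cdot> ?q = ?p" "?q \<cdot> ?p = ?q"
    using arg_cong[OF eq(1), of "\<lambda>x. star S a \<cdot> x"] arg_cong[OF eq(2), of "\<lambda>x. star S b \<cdot> x"] c
    by (simp_all add: star_simps)
  then show "?p = ?q"
    using proj_comm_iff[OF star_prod_proj star_prod_proj] c by metis
next
  assume c: "a \<in> carrier S" "b \<in> carrier S" and eq: "star S a \<cdot> a = star S b \<cdot> b"
  have sub: "left_ideal S x \<subseteq> left_ideal S y"
    if x: "x \<in> carrier S" "y \<in> carrier S" and e: "star S x \<cdot> x = star S y \<cdot> y" for x y
  proof -
    have xy: "x = x \<cdot> star S y \<cdot> y"
      using arg_cong[OF e, of "\<lambda>z. x \<cdot> z"] x by (simp add: star_simps prod_star_prod')
    have "s \<cdot> x = (s \<cdot> x \<cdot> star S y) \<cdot> y" if "s \<in> carrier S" for s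
      using arg_cong[OF xy, of "\<lambda>z. s \<cdot> z"] x that by (simp add: star_simps star_prod_star_left)
    moreover have "x \<cdot> star S y \<in> carrier S" "\<And>s. s \<in> carrier S \<Longrightarrow> s \<cdot> x \<cdot> star S y \<in> carrier S"
      using x by (simp_all add: star_simps)
    ultimately show ?thesis using xy unfolding left_ideal_def by blast
  qed
  show "(a, b) \<in> greenL S"
    using sub[OF c eq] sub[OF c(2,1) eq[symmetric]] c by (auto simp: greenL_def)
qed

section \<open>Idempotents as pairs of projections\<close>

lemma idemD: "e \<in> idempotents S \<Longrightarrow> e \<in> carrier S" "e \<in> idempotents S \<Longrightarrow> e \<cdot> e = e"
  by (auto simp: idempotents_def)

lemma idem_star: "e \<in> idempotents S \<Longrightarrow> star S e \<in> idempotents S"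
  using star_prod[of e e] by (simp add: idempotents_def star_closed)

lemma proj_idem: "p \<in> projections S \<Longrightarrow> p \<in> idempotents S"
  by (simp add: idempotents_def projections_def)

text \<open>The two middle factors merge because \<open>star S e\<close> is idempotent as well. With
  \<open>idem_friendly\<close>, this encodes an idempotent by two projections.\<close>

lemma idem_prod_proj:
  assumes "e \<in> idempotents S"
  shows "e \<cdot> star S e \<cdot> (star S e \<cdot> e) = e"
  using assms idemD[OF assms] idemD(2)[OF idem_star[OF assms]]
    prod_assoc[of "star S e" "star S e" e] by (simp add: star_simps prod_star_prod')

text \<open>Equivalently, \<open>s \<R> s \<cdot> t \<L> t\<close>.\<close>

definition friendly :: "'a \<Rightarrow> 'a \<Rightarrow> bool" where
  "friendly s t \<longleftrightarrow> s \<in> projections S \<and> t \<in> projections S \<and> s \<cdot> (t \<cdot> s) = s \<and> t \<cdot> (s \<cdot> t) = t"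

lemma friendlyD:
  assumes "friendly s t"
  shows "s \<in> projections S" "t \<in> projections S" "s \<cdot> (t \<cdot> s) = s" "t \<cdot> (s \<cdot> t) = t"
    and "x \<in> carrier S \<Longrightarrow> s \<cdot> (t \<cdot> (s \<cdot> x)) = s \<cdot> x"
    and "x \<in> carrier S \<Longrightarrow> t \<cdot> (s \<cdot> (t \<cdot> x)) = t \<cdot> x"
proof -
  show A: "s \<in> projections S" "t \<in> projections S" "s \<cdot> (t \<cdot> s) = s" "t \<cdot> (s \<cdot> t) = t"
    using assms by (auto simp: friendly_def)
  show "x \<in> carrier S \<Longrightarrow> s \<cdot> (t \<cdot> (s \<cdot> x)) = s \<cdot> x"
    using arg_cong[OF A(3), of "\<lambda>y. y \<cdot> x"] A(1,2)[THEN projD(1)] by (simp add: star_simps)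
  show "x \<in> carrier S \<Longrightarrow> t \<cdot> (s \<cdot> (t \<cdot> x)) = t \<cdot> x"
    using arg_cong[OF A(4), of "\<lambda>y. y \<cdot> x"] A(1,2)[THEN projD(1)] by (simp add: star_simps)
qed

lemma friendly_sym: "friendly s t \<Longrightarrow> friendly t s"
  by (simp add: friendly_def)

lemma friendly_prod:
  assumes "friendly s t"
  shows "s \<cdot> t \<in> idempotents S" "s \<cdot> t \<cdot> star S (s \<cdot> t) = s" "star S (s \<cdot> t) \<cdot> (s \<cdot> t) = t"
    "star S (s \<cdot> t) = t \<cdot> s" "s \<cdot> t \<in> carrier S"
  using friendlyD[OF assms] projD[OF friendlyD(1)[OF assms]] projD[OF friendlyD(2)[OF assms]]
  by (simp_all add: idempotents_def star_simps)

lemma idem_friendly: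
  assumes "e \<in> idempotents S"
  shows "friendly (e \<cdot> star S e) (star S e \<cdot> e)"
proof -
  have c: "e \<in> carrier S" "star S e \<in> carrier S" using idemD[OF assms] star_closed by auto
  have e: "e \<cdot> e = e" "star S e \<cdot> star S e = star S e"
    using idemD assms idem_star by auto
  have e': "e \<cdot> (e \<cdot> x) = e \<cdot> x" "star S e \<cdot> (star S e \<cdot> x) = star S e \<cdot> x"
    if "x \<in> carrier S" for x
    using that e c by (metis prod_assoc)+
  show ?thesis unfolding friendly_def
    using c e e' prod_star_proj[OF c(1)] star_prod_proj[OF c(1)]
    by (simp add: star_simps prod_star_prod' prod_star_prod_left star_prod_star star_prod_star_left)
qed

text \<open>The condition on \<open>s\<close> and \<open>p\<close> says that
  \<open>s \<cdot> p\<close> is still in the \<R>-class of \<open>s\<close>. Its \<L>-class has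
  projection \<open>p s p\<close>, so a step by the letter \<open>p\<close> is the idempotent of a
  friendly pair.\<close>

lemma friendly_conj:
  assumes s: "s \<in> projections S" and p: "p \<in> projections S" and sps: "s \<cdot> (p \<cdot> s) = s"
  shows "friendly s (p \<cdot> (s \<cdot> p))" "s \<cdot> (p \<cdot> (s \<cdot> p)) = s \<cdot> p"
proof -
  note [simp] = projD[OF s] projD[OF p] star_simps sps proj_prod_idem[OF s p] proj_prod_idem[OF p s]
  show "friendly s (p \<cdot> (s \<cdot> p))" "s \<cdot> (p \<cdot> (s \<cdot> p)) = s \<cdot> p"
    using s proj_conj[OF p s] by (auto simp: friendly_def)
qed

text \<open>For a column \<open>c\<close> below \<open>p\<close>, left multiplication by
  \<open>p\<close> carries the idempotent in row \<open>s\<close> to the one in row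
  \<open>p s p\<close>.\<close>

lemma friendly_step:
  assumes s: "s \<in> projections S" and p: "p \<in> projections S" and sps: "s \<cdot> (p \<cdot> s) = s"
    and sc: "friendly s c" and cp: "c \<cdot> p = c"
  shows "friendly (p \<cdot> (s \<cdot> p)) c" "p \<cdot> (s \<cdot> c) = p \<cdot> (s \<cdot> p) \<cdot> c"
proof -
  note c = friendlyD(2)[OF sc]
  have pc: "p \<cdot> c = c" using cp c p proj_comm_iff by blast
  have pc': "p \<cdot> (c \<cdot> x) = c \<cdot> x" "c \<cdot> (p \<cdot> x) = c \<cdot> x" if "x \<in> carrier S" for x
    using that cp pc projD(1)[OF c] projD(1)[OF p] by (metis prod_assoc)+
  note [simp] = projD[OF s] projD[OF p] projD[OF c] star_simps sps proj_prod_idem[OF s p]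
    proj_prod_idem[OF p s] friendlyD(3-)[OF sc] cp pc pc'
  show "friendly (p \<cdot> (s \<cdot> p)) c"
    using c proj_conj[OF p s] by (simp add: friendly_def)
  show "p \<cdot> (s \<cdot> c) = p \<cdot> (s \<cdot> p) \<cdot> c" by simp
qed

text \<open>The source of the squares used for the relations of PG(P): \<open>p\<close> is a right
  identity of the top row because \<open>c\<close> and \<open>d\<close> lie below \<open>p\<close>,
  and it moves that row down by \<open>friendly_step\<close>.\<close>

lemma singular_square_conj:
  assumes s: "s \<in> projections S" and p: "p \<in> projections S" and sps: "s \<cdot> (p \<cdot> s) = s"
    and sc: "friendly s c" and sd: "friendly s d" and cp: "c \<cdot> p = c" and dp: "d \<cdot> p = d"
  shows "singular_square S (s \<cdot> c) (s \<cdot> d) (p \<cdot> (s \<cdot> p) \<cdot> c) (p \<cdot> (s \<cdot> p) \<cdot> d)"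
proof -
  let ?t = "p \<cdot> (s \<cdot> p)"
  note tc = friendly_step[OF s p sps sc cp] and td = friendly_step[OF s p sps sd dp]
  have cs: "s \<in> carrier S" "c \<in> carrier S" "d \<in> carrier S" "p \<in> carrier S" "?t \<in> carrier S"
    using s p sc sd projD(1) friendlyD tc by blast+
  have "is_square S (s \<cdot> c) (s \<cdot> d) (?t \<cdot> c) (?t \<cdot> d)"
    unfolding is_square_def greenR_iff greenL_iff
    using friendly_prod[OF sc] friendly_prod[OF sd] friendly_prod[OF tc(1)] friendly_prod[OF td(1)]
    by auto
  moreover have "UD_singularised S (s \<cdot> c) (s \<cdot> d) (?t \<cdot> c) (?t \<cdot> d) p"
    using cs cp dp tc(2) td(2) by (simp add: UD_singularised_def prod_assoc)
  ultimately show ?thesis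
    using proj_idem[OF p] by (auto simp: singular_square_def)
qed

end

section \<open>Words over the projections\<close>

locale projection_presentation = regular_star_semigroup S
  for S :: "('a, 'm) star_sgrp_scheme" (structure) +
  fixes P :: "('a, 'n) proj_alg_scheme"
  assumes projection_algebra: "is_projection_algebra_of P S"
begin

lemma carrier_P: "carrier P = projections S"
  using projection_algebra by (simp add: is_projection_algebra_of_def)

lemma proj_op_eq:
  "\<lbrakk>p \<in> projections S; q \<in> projections S\<rbrakk> \<Longrightarrow> proj_op P p q = p \<cdot> (q \<cdot> p)"
  using projection_algebra
  by (simp add: is_projection_algebra_of_def prod_assoc projD(1))

section \<open>The congruence defining PG(P)\<close>

definition pg_eq :: "'a list \<Rightarrow> 'a list \<Rightarrow> bool" (infix "\<simeq>" 50) where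
  "u \<simeq> v \<longleftrightarrow> (u, v) \<in> word_cong (PG_rels P)"

lemma pg_refl: "u \<simeq> u"
  and pg_sym: "u \<simeq> v \<Longrightarrow> v \<simeq> u"
  and pg_trans [trans]: "\<lbrakk>u \<simeq> v; v \<simeq> w\<rbrakk> \<Longrightarrow> u \<simeq> w"
  unfolding pg_eq_def by (blast intro: word_cong.intros)+

lemma pg_base: "(u, v) \<in> PG_rels P \<Longrightarrow> u \<simeq> v"
  unfolding pg_eq_def by (rule word_cong_base)

lemma pg_context: "u \<simeq> v \<Longrightarrow> x @ u @ y \<simeq> x @ v @ y"
  unfolding pg_eq_def by (rule word_cong_context)

lemma pg_append: "\<lbrakk>u \<simeq> u'; v \<simeq> v'\<rbrakk> \<Longrightarrow> u @ v \<simeq> u' @ v'"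
  unfolding pg_eq_def by (rule word_cong_append)

lemma pg_Cons: "u \<simeq> v \<Longrightarrow> p # u \<simeq> p # v"
  using pg_context[of u v "[p]" "[]"] by simp

lemma PG_rels_cases [consumes 1, case_names idem square conj]:
  assumes "(u, v) \<in> PG_rels P"
  obtains p where "p \<in> projections S" "u = [p, p]" "v = [p]"
  | p q where "p \<in> projections S" "q \<in> projections S" "u = [p, q, p, q]" "v = [p, q]"
  | p q where "p \<in> projections S" "q \<in> projections S" "u = [p, q, p]" "v = [p \<cdot> (q \<cdot> p)]"
  using assms by (auto simp: PG_rels_def carrier_P proj_op_eq)

lemma pg_idem: "p \<in> projections S \<Longrightarrow> p # p # w \<simeq> p # w"
  using pg_context[OF pg_base, of "[p, p]" "[p]" "[]" w]
  by (simp add: PG_rels_def carrier_P)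

lemma pg_square:
  "\<lbrakk>p \<in> projections S; q \<in> projections S\<rbrakk> \<Longrightarrow> p # q # p # q # w \<simeq> p # q # w"
  using pg_context[OF pg_base, of "[p, q, p, q]" "[p, q]" "[]" w]
  by (simp add: PG_rels_def carrier_P)

lemma pg_conj:
  assumes "p \<in> projections S" "q \<in> projections S"
  shows "p # q # p # w \<simeq> p \<cdot> (q \<cdot> p) # w"
proof -
  have "([p, q, p], [p \<cdot> (q \<cdot> p)]) \<in> PG_rels P"
    using assms proj_op_eq[OF assms] unfolding PG_rels_def carrier_P by force
  from pg_context[OF pg_base[OF this], of "[]" w] show ?thesis by simp
qed

lemma pg_lists:
  assumes "u \<simeq> v"
  shows "u \<in> lists (projections S) \<longleftrightarrow> v \<in> lists (projections S)"
  using assms unfolding pg_eq_def by (rule word_cong_lists) (auto elim!: PG_rels_cases simp: proj_conj)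

lemma pg_Nil_iff:
  assumes "u \<simeq> v"
  shows "u = [] \<longleftrightarrow> v = []"
  using assms unfolding pg_eq_def by (rule word_cong_Nil_iff) (auto elim!: PG_rels_cases)

text \<open>Reversal maps each family of defining relations to itself, so it induces the star of
  PG(P).\<close>

lemma pg_rev:
  assumes "u \<simeq> v"
  shows "rev u \<simeq> rev v"
  using assms[unfolded pg_eq_def]
proof induction
  case (rel u v x y)
  then have "rev u \<simeq> rev v"
    by (cases rule: PG_rels_cases) (auto intro: pg_idem pg_square pg_conj)
  then show ?case using pg_context[of "rev u" "rev v" "rev y" "rev x"] by simp
qed (blast intro: pg_refl pg_sym pg_trans)+

text \<open>The generators act on projections by \<open>q \<mapsto> p q p\<close>. As long as a word \<open>w\<close> \<^emph>\<open>stays\<close> in the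
  \<open>\<R>\<close>-class of \<open>s\<close>, the projection \<open>act s w\<close> is the label of the \<open>\<L>\<close>-class of \<open>s w\<close>.\<close>

primrec act :: "'a \<Rightarrow> 'a list \<Rightarrow> 'a" where
  "act s [] = s"
| "act s (p # w) = act (p \<cdot> (s \<cdot> p)) w"

primrec stays :: "'a \<Rightarrow> 'a list \<Rightarrow> bool" where
  "stays s [] = True"
| "stays s (p # w) = (s \<cdot> (p \<cdot> s) = s \<and> stays (p \<cdot> (s \<cdot> p)) w)"

lemma act_append: "act s (u @ v) = act (act s u) v"
  by (induction u arbitrary: s) auto

lemma stays_append: "stays s (u @ v) \<longleftrightarrow> stays s u \<and> stays (act s u) v"
  by (induction u arbitrary: s) auto

lemma act_proj: "\<lbrakk>s \<in> projections S; w \<in> lists (projections S)\<rbrakk> \<Longrightarrow> act s w \<in> projections S"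
  by (induction w arbitrary: s) (auto simp: proj_conj)

text \<open>If \<open>x\<close> is the value of \<open>w\<close> in \<open>S\<close>, then
  \<open>act s w\<close> is \<open>star S x \<cdot> s \<cdot> x\<close>, and
  \<open>stays s w\<close> says that \<open>s\<close> and \<open>s \<cdot> x\<close> are
  \<R>-related. So both depend only on a value that respects the relations; the proof verifies this
  relation by relation.\<close>

lemma pg_act_stays:
  assumes "u \<simeq> v" and "s \<in> projections S" and "u \<in> lists (projections S)"
  shows "act s u = act s v \<and> (stays s u \<longleftrightarrow> stays s v)"
  using assms[unfolded pg_eq_def]
proof (induction arbitrary: s)
  case (rel u v x y)
  define s' where "s' = act s x"
  have s': "s' \<in> projections S" unfolding s'_def using rel act_proj by auto
  have "act s' u = act s' v \<and> (stays s' u \<longleftrightarrow> stays s' v)"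
    using rel(1)
  proof (cases rule: PG_rels_cases)
    case (idem p)
    note [simp] = projD[OF s'] projD[OF idem(1)] star_simps proj_prod_idem[OF s' idem(1)]
      proj_prod_idem[OF idem(1) s']
    show ?thesis using idem by auto
  next
    case (square p q)
    note ps = s' square(1,2)
    note [simp] = ps[THEN projD(1)] ps[THEN projD(2)] ps[THEN projD(4)] star_simps
      proj_prod_idem[OF square(1,2)] proj_prod_idem[OF square(2,1)]
    have "stays s' v \<Longrightarrow> stays s' u"
    proof -
      assume v: "stays s' v"
      \<comment> \<open>The labels reached after \<open>p\<close>, \<open>p q\<close> and
        \<open>p q p\<close>. The first two steps are given; the last two have to be shown to
        stay.\<close>
      define t where "t = p \<cdot> (s' \<cdot> p)"
      define u1 where "u1 = q \<cdot> (t \<cdot> q)"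
      define v1 where "v1 = p \<cdot> (u1 \<cdot> p)"
      have t: "t \<cdot> (q \<cdot> t) = t" using v square t_def by simp
      have t': "p \<cdot> t = t" "t \<cdot> p = t" "t \<in> projections S"
        using proj_conj[OF square(1) s'] by (auto simp: t_def)
      have c [simp]: "t \<in> carrier S" "t \<cdot> t = t" using projD[OF t'(3)] by auto
      have ptx [simp]: "p \<cdot> (t \<cdot> x) = t \<cdot> x" "t \<cdot> (p \<cdot> x) = t \<cdot> x" "t \<cdot> (t \<cdot> x) = t \<cdot> x"
        "t \<cdot> (q \<cdot> (t \<cdot> x)) = t \<cdot> x" if "x \<in> carrier S" for x
        using that t' t c \<open>p \<in> projections S\<close>[THEN projD(1)] \<open>q \<in> projections S\<close>[THEN projD(1)]
        by (metis prod_assoc prod_closed)+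
      have u1: "u1 \<cdot> (p \<cdot> u1) = u1"
      proof -
        \<comment> \<open>Since \<open>t \<cdot> p = t\<close>, a \<open>p\<close> can be inserted
          after \<open>t\<close>; it completes \<open>p q p q\<close>, which contracts.\<close>
        have "t \<cdot> (q \<cdot> (p \<cdot> (q \<cdot> t))) = t \<cdot> (p \<cdot> (q \<cdot> (p \<cdot> (q \<cdot> t))))" by (rule ptx(2)[symmetric]) simp
        also have "\<dots> = t \<cdot> (p \<cdot> (q \<cdot> t))" by (simp del: ptx)
        also have "\<dots> = t" using t by simp
        finally have k: "t \<cdot> (q \<cdot> (p \<cdot> (q \<cdot> t))) = t" .
        have "u1 \<cdot> (p \<cdot> u1) = q \<cdot> ((t \<cdot> (q \<cdot> (p \<cdot> (q \<cdot> t)))) \<cdot> q)" by (simp add: u1_def)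
        then show ?thesis unfolding k by (simp add: u1_def)
      qed
      have v1: "v1 \<cdot> (q \<cdot> v1) = v1"
      proof -
        have "v1 = p \<cdot> (q \<cdot> (t \<cdot> (q \<cdot> p)))" by (simp add: v1_def u1_def)
        moreover have "t \<cdot> (q \<cdot> (p \<cdot> (q \<cdot> (p \<cdot> (q \<cdot> t))))) = t"
        proof -
          have "t \<cdot> (q \<cdot> (p \<cdot> (q \<cdot> (p \<cdot> (q \<cdot> t))))) = t \<cdot> (p \<cdot> (q \<cdot> (p \<cdot> (q \<cdot> (p \<cdot> (q \<cdot> t))))))" by (rule ptx(2)[symmetric]) simp
          also have "\<dots> = t \<cdot> (p \<cdot> (q \<cdot> t))" by (simp del: ptx)
          also have "\<dots> = t" using t by simp
          finally show ?thesis .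
        qed
        then have "p \<cdot> (q \<cdot> ((t \<cdot> (q \<cdot> (p \<cdot> (q \<cdot> (p \<cdot> (q \<cdot> t)))))) \<cdot> (q \<cdot> p))) = p \<cdot> (q \<cdot> (t \<cdot> (q \<cdot> p)))"
          by (rule arg_cong)
        ultimately show ?thesis by simp
      qed
      show ?thesis
        using v square u1 v1 by (simp add: t_def[symmetric] u1_def[symmetric] v1_def[symmetric])
    qed
    moreover have "stays s' u \<Longrightarrow> stays s' v" using square by simp
    moreover have "act s' u = act s' v" using square by simp
    ultimately show ?thesis by blast
  next
    case (conj p q)
    note ps = s' conj(1,2)
    note [simp] = ps[THEN projD(1)] ps[THEN projD(2)] ps[THEN projD(4)] star_simps
      proj_prod_idem[OF conj(1,2)] proj_prod_idem[OF conj(2,1)]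
      proj_prod_idem[OF conj(1) s'] proj_prod_idem[OF s' conj(1)]
    let ?m = "p \<cdot> (q \<cdot> p)"
    have "stays s' v \<longleftrightarrow> stays s' u"
    proof
      assume "stays s' v"
      then have m: "s' \<cdot> (p \<cdot> (q \<cdot> (p \<cdot> s'))) = s'" using conj by simp
      have m': "s' \<cdot> (p \<cdot> (q \<cdot> (p \<cdot> (s' \<cdot> x)))) = s' \<cdot> x" if "x \<in> carrier S" for x
        using arg_cong[OF m, of "\<lambda>y. y \<cdot> x"] that by simp
      \<comment> \<open>Expanding the last \<open>s'\<close> by \<open>m\<close> brings
        \<open>s' p s' p\<close> together, which contracts to \<open>s' p\<close>.\<close>
      have "s' \<cdot> (p \<cdot> s') = s' \<cdot> (p \<cdot> (s' \<cdot> (p \<cdot> (q \<cdot> (p \<cdot> s')))))" by (simp only: m)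
      also have "\<dots> = s' \<cdot> (p \<cdot> (q \<cdot> (p \<cdot> s')))" by simp
      finally have 1: "s' \<cdot> (p \<cdot> s') = s'" using m by simp
      have 2: "p \<cdot> (s' \<cdot> p) \<cdot> (q \<cdot> (p \<cdot> (s' \<cdot> p))) = p \<cdot> (s' \<cdot> p)"
        using m' by simp
      have "s' \<cdot> (p \<cdot> (q \<cdot> (p \<cdot> (q \<cdot> (p \<cdot> (s' \<cdot> (p \<cdot> q))))))) = s' \<cdot> (p \<cdot> q)"
        using m' by simp
      then have 3: "q \<cdot> (p \<cdot> (s' \<cdot> (p \<cdot> (q \<cdot> (p \<cdot> (q \<cdot> (p \<cdot> (s' \<cdot> (p \<cdot> q))))))))) = q \<cdot> (p \<cdot> (s' \<cdot> (p \<cdot> q)))"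
        by (rule arg_cong[of _ _ "\<lambda>y. q \<cdot> (p \<cdot> y)"])
      show "stays s' u" using conj 1 2 3 by simp
    next
      assume "stays s' u"
      then have 1: "s' \<cdot> (p \<cdot> s') = s'" and 2: "p \<cdot> (s' \<cdot> p) \<cdot> (q \<cdot> (p \<cdot> (s' \<cdot> p))) = p \<cdot> (s' \<cdot> p)"
        using conj by auto
      have "s' \<cdot> (p \<cdot> (q \<cdot> (p \<cdot> s'))) = s' \<cdot> (p \<cdot> (s' \<cdot> p) \<cdot> (q \<cdot> (p \<cdot> (s' \<cdot> p)))) \<cdot> s'" by simp
      also have "\<dots> = s' \<cdot> (p \<cdot> s')" unfolding 2 by simp
      finally have "s' \<cdot> (p \<cdot> (q \<cdot> (p \<cdot> s'))) = s'" using 1 by simp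
      then show "stays s' v" using conj by simp
    qed
    then show ?thesis using conj by simp
  qed
  then show ?case by (simp add: act_append stays_append s'_def)
next
  case (trans u v w)
  then show ?case using pg_lists[unfolded pg_eq_def] by metis
qed (use pg_lists[unfolded pg_eq_def] in auto)

text \<open>The action separates letters: applied to \<open>p\<close> and to \<open>q\<close>, it
  gives \<open>q p q = p\<close> and \<open>p q p = q\<close>, which forces \<open>p = q\<close>.
  Hence \<open>P\<close> embeds in PG(P).\<close>

lemma pg_singleton_eq:
  assumes "[p] \<simeq> [q]" "p \<in> projections S" "q \<in> projections S"
  shows "p = q"
proof -
  have 1: "q \<cdot> (p \<cdot> q) = p"
    using pg_act_stays[OF assms(1,2)] assms(2) by (simp add: projD)
  have 2: "p \<cdot> (q \<cdot> p) = q"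
    using pg_act_stays[OF assms(1,3)] assms by (simp add: projD)
  have "q \<cdot> p = p" using 1 assms(2,3) by (metis projD(1,4) prod_closed)
  moreover have "q \<cdot> p = q" using 2 assms(2,3) 1 calculation by (metis projD(2))
  ultimately show ?thesis by simp
qed

text \<open>The conjugation relation consumes the word from its centre outwards.\<close>

lemma rev_conj_act:
  assumes "s \<in> projections S" "w \<in> lists (projections S)"
  shows "rev w @ s # w \<simeq> [act s w]"
  using assms
proof (induction w arbitrary: s)
  case (Cons p w)
  have "rev (p # w) @ s # p # w = rev w @ [p, s, p] @ w" by simp
  also have "\<dots> \<simeq> rev w @ [p \<cdot> (s \<cdot> p)] @ w"
    using Cons pg_conj[of p s "[]"] by (intro pg_context) auto
  also have "\<dots> \<simeq> [act s (p # w)]"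
    using Cons.IH[of "p \<cdot> (s \<cdot> p)"] Cons.prems proj_conj by auto
  finally show ?case .
qed (auto intro: pg_refl)

lemma rev_append_self:
  assumes "p # w \<in> lists (projections S)"
  shows "rev (p # w) @ p # w \<simeq> [act p w]"
proof -
  have "rev w @ (p # p # w) \<simeq> rev w @ (p # w)"
    using assms by (intro pg_append pg_idem pg_refl) auto
  also have "\<dots> \<simeq> [act p w]" using assms by (intro rev_conj_act) auto
  finally show ?thesis by simp
qed

lemma rev_lists_iff [simp]: "rev w \<in> lists X \<longleftrightarrow> w \<in> lists X"
  by (simp add: in_lists_conv_set)

lemma append_rev_proj:
  assumes "w \<in> lists (projections S)" "w \<noteq> []"
  obtains r where "r \<in> projections S" "w @ rev w \<simeq> [r]"
proof -
  obtain p v where v: "rev w = p # v" using assms by (cases "rev w") auto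
  then have "p # v \<in> lists (projections S)" using assms(1) by (metis rev_lists_iff)
  then show ?thesis
    using that[of "act p v"] rev_append_self[of p v] act_proj[of p v] v by (auto simp: rev_swap)
qed

text \<open>\<open>w @ rev w\<close> collapses to a letter \<open>m\<close>, which fixes
  \<open>w\<close> on the left by induction; for \<open>p # w\<close> what remains is the square
  relation for \<open>p\<close> and \<open>m\<close>.\<close>

lemma pg_regular:
  assumes "w \<in> lists (projections S)"
  shows "w @ rev w @ w \<simeq> w"
  using assms
proof (induction w rule: list.induct)
  case (Cons p w)
  have p: "p \<in> projections S" and w: "w \<in> lists (projections S)" using Cons.prems by auto
  show ?case
  proof (cases "w = []")
    case True
    have "[p, p, p] \<simeq> [p, p]" using p by (rule pg_idem)
    also have "\<dots> \<simeq> [p]" using p by (rule pg_idem)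
    finally show ?thesis using True by simp
  next
    case False
    obtain m where m: "m \<in> projections S" "w @ rev w \<simeq> [m]" using append_rev_proj[OF w False] .
    have mw: "m # w \<simeq> w"
    proof -
      have "[m] @ w \<simeq> (w @ rev w) @ w" using m by (intro pg_append pg_sym[OF m(2)] pg_refl)
      also have "\<dots> \<simeq> w" using Cons by simp
      finally show ?thesis by simp
    qed
    have "[p] @ (w @ rev w) @ (p # p # w) \<simeq> [p] @ [m] @ (p # w)"
      using m p by (intro pg_append pg_idem pg_refl) auto
    also have "\<dots> \<simeq> [p, m, p] @ (m # w)"
      using pg_context[OF pg_sym[OF mw], of "[p, m, p]" "[]"] by simp
    also have "\<dots> \<simeq> p # m # w" using pg_square[OF p m(1)] by simp
    also have "\<dots> \<simeq> p # w" using mw by (rule pg_Cons)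
    finally show ?thesis by simp
  qed
qed (auto intro: pg_refl)

text \<open>In the groupoid of \<open>\<H>\<close>-classes, the class of \<open>w\<close> is a morphism from \<open>s\<close> to \<open>t\<close>.\<close>

definition arrow :: "'a \<Rightarrow> 'a list \<Rightarrow> 'a \<Rightarrow> bool" where
  "arrow s w t \<longleftrightarrow> s \<in> projections S \<and> t \<in> projections S \<and> w \<in> lists (projections S) \<and> w \<noteq> [] \<and>
     w @ rev w \<simeq> [s] \<and> rev w @ w \<simeq> [t]"

lemma arrowD:
  assumes "arrow s w t"
  shows "s \<in> projections S" "t \<in> projections S" "w \<in> lists (projections S)" "w \<noteq> []"
    "w @ rev w \<simeq> [s]" "rev w @ w \<simeq> [t]"
  using assms by (auto simp: arrow_def)

lemma arrow_absorb:
  assumes "arrow s w t"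
  shows "s # w \<simeq> w" "w @ [t] \<simeq> w"
proof -
  note a = arrowD[OF assms]
  have "[s] @ w \<simeq> (w @ rev w) @ w" by (intro pg_append pg_sym[OF a(5)] pg_refl)
  also have "\<dots> \<simeq> w" using pg_regular[OF a(3)] by simp
  finally show "s # w \<simeq> w" by simp
  have "w @ [t] \<simeq> w @ (rev w @ w)" by (intro pg_append pg_sym[OF a(6)] pg_refl)
  also have "\<dots> \<simeq> w" using pg_regular[OF a(3)] by simp
  finally show "w @ [t] \<simeq> w" .
qed

lemma arrow_rev:
  assumes "arrow s w t"
  shows "arrow t (rev w) s"
  using arrowD[OF assms] by (simp add: arrow_def)

lemma arrow_append:
  assumes "arrow s u t" "arrow t v r"
  shows "arrow s (u @ v) r"
proof -
  note a = arrowD[OF assms(1)] and b = arrowD[OF assms(2)]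
  have *: "x @ y @ rev y @ rev x \<simeq> [s]" if x: "arrow s x t" and y: "arrow t y r" for x y s t r
  proof -
    have "x @ (y @ rev y) @ rev x \<simeq> x @ [t] @ rev x" by (rule pg_context[OF arrowD(5)[OF y]])
    also have "\<dots> \<simeq> x @ rev x" using pg_append[OF arrow_absorb(2)[OF x] pg_refl] by simp
    also have "\<dots> \<simeq> [s]" using arrowD[OF x] by simp
    finally show ?thesis by simp
  qed
  show ?thesis
    using a b *[OF assms] *[OF arrow_rev[OF assms(2)] arrow_rev[OF assms(1)]]
    by (simp add: arrow_def)
qed

text \<open>The word \<open>[s]\<close> stays at \<open>s\<close>, hence so do the equivalent word
  \<open>w @ rev w\<close> and its prefix \<open>w\<close>. The end point is found by collapsing
  \<open>rev w @ s # w\<close> in two ways.\<close>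

lemma arrow_stays:
  assumes "arrow s w t"
  shows "stays s w" "act s w = t"
proof -
  note a = arrowD[OF assms]
  have "stays s (w @ rev w)"
    using pg_act_stays[OF a(5) a(1)] a(1,3) by (simp add: projD)
  then show "stays s w" by (simp add: stays_append)
  have "[act s w] \<simeq> rev w @ (s # w)" using rev_conj_act[OF a(1,3)] by (rule pg_sym)
  also have "\<dots> \<simeq> rev w @ w" using arrow_absorb[OF assms] by (intro pg_append pg_refl)
  also have "\<dots> \<simeq> [t]" using a by simp
  finally show "act s w = t" using a act_proj[OF a(1,3)] pg_singleton_eq by blast
qed

lemma arrow_friendly:
  assumes "friendly s t"
  shows "arrow s [s, t] t"
proof -
  note f = friendlyD[OF assms]
  have *: "[x, y, y, x] \<simeq> [x]" if "friendly x y" for x y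
  proof -
    note f = friendlyD[OF that]
    have "[x] @ [y, y, x] \<simeq> [x] @ [y, x]" using f by (intro pg_append pg_refl pg_idem)
    also have "\<dots> \<simeq> [x]" using pg_conj[of x y "[]"] f by simp
    finally show ?thesis by simp
  qed
  show ?thesis
    using f *[OF assms] *[OF friendly_sym[OF assms]] by (simp add: arrow_def)
qed

lemma arrow_proj: "s \<in> projections S \<Longrightarrow> arrow s [s] s"
  by (simp add: arrow_def pg_idem)

section \<open>Lifting singular squares from S to PG(P)\<close>

lemma pg_below:
  assumes "p \<in> projections S" "r \<in> projections S" "p \<cdot> r = r"
  shows "p # r # w \<simeq> r # w"
proof -
  have rp: "r \<cdot> p = r" using assms proj_comm_iff by blast
  have r: "p # r # p # w \<simeq> r # w" for w using pg_conj[of p r w] assms rp by simp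
  have "[p] @ (r # w) \<simeq> [p] @ (p # r # p # w)" by (intro pg_append pg_refl pg_sym[OF r])
  also have "\<dots> \<simeq> p # r # p # w" using assms(1) pg_idem by simp
  also have "\<dots> \<simeq> r # w" by (rule r)
  finally show ?thesis by simp
qed

text \<open>In \<open>w @ rev w @ w\<close> the middle factor may be doubled, which leaves the
  product of the two end projections. So an idempotent of PG(P) is determined by its source and
  target.\<close>

lemma pg_idempotent:
  assumes w: "arrow r w c" and idem: "w @ w \<simeq> w"
  shows "w \<simeq> [r, c]"
proof -
  note a = arrowD[OF w]
  have "w \<simeq> w @ rev w @ w" using pg_regular[OF a(3)] by (rule pg_sym)
  also have "\<dots> \<simeq> w @ rev (w @ w) @ w" by (intro pg_append pg_refl pg_rev pg_sym[OF idem])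
  also have "\<dots> = (w @ rev w) @ (rev w @ w)" by simp
  also have "\<dots> \<simeq> [r] @ [c]" using a by (intro pg_append)
  finally show ?thesis by simp
qed

text \<open>The equation in \<open>S\<close> puts \<open>r\<close> below \<open>j\<close>. So a
  \<open>j\<close> can be inserted before \<open>r\<close>, then \<open>j k j\<close> collapses to
  \<open>j\<close>, and \<open>r\<close> absorbs it.\<close>

lemma pg_left_identity:
  assumes jk: "friendly j k" and rc: "friendly r c" and u: "j \<cdot> k \<cdot> (r \<cdot> c) = r \<cdot> c"
  shows "j # k # r # w \<simeq> r # w"
proof -
  note f = friendlyD[OF jk] friendlyD[OF rc]
  note ps = f(1,2,7,8)
  note [simp] = ps[THEN projD(1)] ps[THEN projD(2)] ps[THEN projD(4)] star_simps f
  have "j \<cdot> (k \<cdot> r) = j \<cdot> k \<cdot> (r \<cdot> c) \<cdot> r" by simp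
  also have "\<dots> = r" unfolding u by simp
  finally have jkr: "j \<cdot> (k \<cdot> r) = r" .
  have "j \<cdot> r = j \<cdot> (j \<cdot> (k \<cdot> r))" by (simp only: jkr)
  also have "\<dots> = j \<cdot> (k \<cdot> r)" by simp
  also note jkr
  finally have jr: "j \<cdot> r = r" .
  have "[j, k] @ (r # w) \<simeq> [j, k] @ (j # r # w)"
    using ps jr by (intro pg_append pg_refl pg_sym[OF pg_below])
  also have "\<dots> \<simeq> j # r # w" using pg_conj[of j k "r # w"] ps by simp
  also have "\<dots> \<simeq> r # w" using ps jr by (intro pg_below)
  finally show ?thesis by simp
qed

text \<open>The right-hand word no longer mentions \<open>r\<close>, which lets two rows be
  identified. The word \<open>[r, c, j, k]\<close> is an idempotent of PG(P) from \<open>r\<close>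
  to \<open>d\<close>, hence it is \<open>[r, d]\<close>.\<close>

lemma pg_right_translate:
  assumes jk: "friendly j k" and rc: "friendly r c" and rd: "friendly r d"
    and u: "j \<cdot> k \<cdot> (r \<cdot> c) = r \<cdot> c" "r \<cdot> c \<cdot> (j \<cdot> k) = r \<cdot> d"
  shows "[c, r, d] \<simeq> [c, j, k]"
proof -
  note f = friendlyD(1,2)[OF jk] friendlyD(1,2)[OF rc] friendlyD(1,2)[OF rd]
  note ps = f[THEN projD(1)]
  note star = f[THEN projD(3)]
  let ?w = "[r, c, j, k]"
  \<comment> \<open>The end points come from the action, which is computed in \<open>S\<close>,
    where the product is known to be \<open>r \<cdot> d\<close>.\<close>
  have "rev ?w @ ?w \<simeq> [act r [c, j, k]]" using f by (intro rev_append_self) auto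
  also have "act r [c, j, k] = star S (r \<cdot> c \<cdot> (j \<cdot> k)) \<cdot> (r \<cdot> c \<cdot> (j \<cdot> k))"
    using ps star f by (simp add: star_simps projD(2,4))
  also have "\<dots> = d" unfolding u using friendly_prod[OF rd] by simp
  finally have 1: "rev ?w @ ?w \<simeq> [d]" .
  have "rev (rev ?w) @ rev ?w \<simeq> [act k [j, c, r]]"
    using f rev_append_self[of k "[j, c, r]"] by simp
  also have "act k [j, c, r] = (r \<cdot> c \<cdot> (j \<cdot> k)) \<cdot> star S (r \<cdot> c \<cdot> (j \<cdot> k))"
    using ps star f by (simp add: star_simps projD(2,4))
  also have "\<dots> = r" unfolding u using friendly_prod[OF rd] by simp
  finally have 2: "?w @ rev ?w \<simeq> [r]" by simp
  have arr: "arrow r ?w d" using 1 2 f by (simp add: arrow_def)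
  \<comment> \<open>Idempotency: \<open>j k\<close> is a left identity before \<open>r\<close>, and
    \<open>r c r c\<close> contracts.\<close>
  have "[r, c] @ (j # k # r # [c, j, k]) \<simeq> [r, c] @ (r # [c, j, k])"
    by (intro pg_append pg_refl pg_left_identity[OF jk rc u(1)])
  also have "\<dots> \<simeq> ?w" using f pg_square by simp
  finally have "?w @ ?w \<simeq> ?w" by simp
  then have w: "?w \<simeq> [r, d]" by (rule pg_idempotent[OF arr])
  have "[c] @ [r, d] \<simeq> [c] @ ?w" by (intro pg_append pg_refl pg_sym[OF w])
  also have "\<dots> \<simeq> c \<cdot> (r \<cdot> c) # [j, k]" using f pg_conj by simp
  also have "\<dots> = [c, j, k]" using friendlyD(4)[OF rc] by simp
  finally show ?thesis by simp
qed

lemma pg_LR: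
  assumes "friendly j k" "friendly r c" "friendly r d" "friendly r' c" "friendly r' d"
    and "LR_singularised S (r \<cdot> c) (r \<cdot> d) (r' \<cdot> c) (r' \<cdot> d) (j \<cdot> k)"
  shows "[c, r, d] \<simeq> [c, r', d]"
  using pg_right_translate[of j k r c d] pg_right_translate[of j k r' c d] assms
  unfolding LR_singularised_def by (meson pg_sym pg_trans)

text \<open>The star transposes the square and makes it LR-singularised by
  \<open>k \<cdot> j\<close>. Then \<open>pg_LR\<close> compares the columns; expanding
  \<open>d\<close> to \<open>d r' d\<close> and contracting \<open>c r c\<close> turns this into a
  comparison of the rows.\<close>

lemma pg_UD:
  assumes fr: "friendly j k" "friendly r c" "friendly r d" "friendly r' c" "friendly r' d"
    and ud: "UD_singularised S (r \<cdot> c) (r \<cdot> d) (r' \<cdot> c) (r' \<cdot> d) (j \<cdot> k)"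
  shows "[c, r, d] \<simeq> [c, r', d]"
proof -
  note ps = friendlyD(1,2)[OF fr(1)] friendlyD(1,2)[OF fr(2)] friendlyD(1,2)[OF fr(5)]
  have star: "star S (x \<cdot> y) = y \<cdot> x" "x \<cdot> y \<in> carrier S"
    if "x \<in> projections S" "y \<in> projections S" for x y
    using that by (simp_all add: projD star_simps)
  have star4: "star S (x \<cdot> y \<cdot> (z \<cdot> w)) = w \<cdot> z \<cdot> (y \<cdot> x)"
    if "x \<in> projections S" "y \<in> projections S" "z \<in> projections S" "w \<in> projections S" for x y z w
    using that by (simp add: star star_prod)
  have "LR_singularised S (c \<cdot> r) (c \<cdot> r') (d \<cdot> r) (d \<cdot> r') (k \<cdot> j)"
    unfolding LR_singularised_def
    using ud[unfolded UD_singularised_def, THEN conjunct1, THEN arg_cong, of "star S"]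
      ud[unfolded UD_singularised_def, THEN conjunct2, THEN conjunct1, THEN arg_cong, of "star S"]
      ud[unfolded UD_singularised_def, THEN conjunct2, THEN conjunct2, THEN conjunct1, THEN arg_cong, of "star S"]
      ud[unfolded UD_singularised_def, THEN conjunct2, THEN conjunct2, THEN conjunct2, THEN arg_cong, of "star S"]
      ps by (simp add: star star4)
  then have "[r, c, r'] \<simeq> [r, d, r']"
    using fr friendly_sym by (intro pg_LR[of k j]) auto
  note eq = pg_sym[OF this]
  have "[c, r] @ [d] \<simeq> [c, r] @ [d, r', d]"
    using pg_conj[of d r' "[]"] ps friendlyD(4)[OF fr(5)] pg_sym
    by (intro pg_append pg_refl) auto
  also have "\<dots> = [c] @ [r, d, r'] @ [d]" by simp
  also have "\<dots> \<simeq> [c] @ [r, c, r'] @ [d]" by (rule pg_context[OF eq])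
  also have "\<dots> = [c, r, c] @ [r', d]" by simp
  also have "\<dots> \<simeq> [c] @ [r', d]"
    using pg_conj[of c r "[]"] ps friendlyD(4)[OF fr(2)] by (intro pg_append pg_refl) auto
  finally show ?thesis by simp
qed

text \<open>The words are the arrows "inverse of \<open>e\<close>, then \<open>f\<close>" and
  "inverse of \<open>g\<close>, then \<open>h\<close>". The RL case follows from LR by reversal, the
  DU case from UD by exchanging the rows.\<close>

lemma pg_singular_square:
  assumes "singular_square S e f g h"
  shows "[star S e \<cdot> e, e \<cdot> star S e, star S f \<cdot> f] \<simeq> [star S g \<cdot> g, g \<cdot> star S g, star S h \<cdot> h]"
proof -
  define r c r' d where "r = e \<cdot> star S e" and "c = star S e \<cdot> e" and "r' = g \<cdot> star S g"
    and "d = star S f \<cdot> f"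
  have sq: "is_square S e f g h" using assms by (simp add: singular_square_def)
  then have idem: "e \<in> idempotents S" "f \<in> idempotents S" "g \<in> idempotents S" "h \<in> idempotents S"
    and eqs: "f \<cdot> star S f = r" "star S g \<cdot> g = c" "h \<cdot> star S h = r'" "star S h \<cdot> h = d"
    by (auto simp: is_square_def greenR_iff greenL_iff r_def c_def r'_def d_def)
  have fr: "friendly r c" "friendly r d" "friendly r' c" "friendly r' d"
    using idem[THEN idem_friendly] eqs by (auto simp: r_def c_def r'_def d_def)
  have prods: "e = r \<cdot> c" "f = r \<cdot> d" "g = r' \<cdot> c" "h = r' \<cdot> d"
    using idem[THEN idem_prod_proj] eqs by (auto simp: r_def c_def r'_def d_def)
  obtain u where u: "u \<in> idempotents S"
    "LR_singularised S e f g h u \<or> RL_singularised S e f g h u \<or>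
     UD_singularised S e f g h u \<or> DU_singularised S e f g h u"
    using assms by (auto simp: singular_square_def)
  define j k where "j = u \<cdot> star S u" and "k = star S u \<cdot> u"
  have jk: "friendly j k" "u = j \<cdot> k"
    using u(1) idem_friendly idem_prod_proj by (auto simp: j_def k_def)
  have main: "[c, r, d] \<simeq> [c, r', d]"
    using u(2) unfolding prods jk(2) RL_singularised_def DU_singularised_def
  proof (elim disjE)
    assume "LR_singularised S (r \<cdot> d) (r \<cdot> c) (r' \<cdot> d) (r' \<cdot> c) (j \<cdot> k)"
    then have "[d, r, c] \<simeq> [d, r', c]" using jk fr by (intro pg_LR[of j k])
    from pg_rev[OF this] show ?thesis by simp
  next
    assume "UD_singularised S (r' \<cdot> c) (r' \<cdot> d) (r \<cdot> c) (r \<cdot> d) (j \<cdot> k)"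
    then have "[c, r', d] \<simeq> [c, r, d]" using jk fr by (intro pg_UD[of j k])
    then show ?thesis by (rule pg_sym)
  qed (use jk fr pg_LR pg_UD in blast)+
  then show ?thesis using eqs by (simp add: r_def c_def r'_def d_def)
qed

end

section \<open>The group and the labelling of paths\<close>

locale subgroup_presentation = projection_presentation S P
  for S :: "('a, 'm) star_sgrp_scheme" (structure) and P :: "('a, 'n) proj_alg_scheme" +
  fixes p0 :: 'a and D T :: "'a set"
  assumes p0: "p0 \<in> projections S"
    and D_def: "D = greenD S `` {p0}"
    and spanning_tree: "GH_spanning_tree S D T"
    and proj_tree: "projections S \<inter> D \<subseteq> T"
begin

definition E :: "'a set" where "E = idempotents S \<inter> D"

definition PD :: "'a set" where "PD = projections S \<inter> D"

lemma PD_proj: "s \<in> PD \<Longrightarrow> s \<in> projections S"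
  by (simp add: PD_def)

lemma p0_D: "p0 \<in> D"
  using projD(1)[OF p0] unfolding D_def greenD_def Image_singleton_iff
  by (intro r_into_trancl UnI1) (simp add: greenR_iff)

lemma p0_PD: "p0 \<in> PD"
  using p0 p0_D by (simp add: PD_def)

lemma D_greenR: "\<lbrakk>x \<in> D; (x, y) \<in> greenR S\<rbrakk> \<Longrightarrow> y \<in> D"
  and D_greenL: "\<lbrakk>x \<in> D; (x, y) \<in> greenL S\<rbrakk> \<Longrightarrow> y \<in> D"
  unfolding D_def greenD_def by (auto intro: trancl_into_trancl)

lemma T_E: "T \<subseteq> E"
  using spanning_tree by (simp add: GH_spanning_tree_def E_def)

lemma PD_T: "s \<in> PD \<Longrightarrow> s \<in> T"
  using proj_tree by (auto simp: PD_def)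

lemma friendly_D:
  assumes "friendly s t" "s \<in> PD"
  shows "t \<in> PD" "s \<cdot> t \<in> E"
proof -
  note f = friendlyD(1,2)[OF assms(1)]
  note ps = f[THEN projD(1)] f[THEN projD(2)] f[THEN projD(3)]
  have "(s, s \<cdot> t) \<in> greenR S"
    unfolding greenR_iff using friendly_prod[OF assms(1)] ps by simp
  then have st: "s \<cdot> t \<in> D" using assms(2) D_greenR by (auto simp: PD_def)
  moreover have "(s \<cdot> t, t) \<in> greenL S"
    unfolding greenL_iff using friendly_prod[OF assms(1)] ps by simp
  ultimately show "t \<in> PD" using f D_greenL by (auto simp: PD_def)
  show "s \<cdot> t \<in> E" using st friendly_prod(1)[OF assms(1)] by (simp add: E_def)
qed

lemma conj_PD:
  assumes "s \<in> PD" "p \<in> projections S" "s \<cdot> (p \<cdot> s) = s"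
  shows "p \<cdot> (s \<cdot> p) \<in> PD"
  using friendly_D(1)[OF friendly_conj(1)[OF PD_proj[OF assms(1)] assms(2,3)] assms(1)] .

lemma E_proj:
  assumes "e \<in> E"
  shows "e \<cdot> star S e \<in> PD" "star S e \<cdot> e \<in> PD" "star S e \<in> E" "e \<in> carrier S"
    "friendly (e \<cdot> star S e) (star S e \<cdot> e)" "e \<cdot> star S e \<cdot> (star S e \<cdot> e) = e"
proof -
  have e: "e \<in> idempotents S" "e \<in> D" using assms by (auto simp: E_def)
  show c: "e \<in> carrier S" using e idemD by blast
  show f: "friendly (e \<cdot> star S e) (star S e \<cdot> e)" using e idem_friendly by blast
  show "e \<cdot> star S e \<cdot> (star S e \<cdot> e) = e" using e idem_prod_proj by blast
  have "(e, e \<cdot> star S e) \<in> greenR S"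
    using c friendlyD(1)[OF f] projD[of "e \<cdot> star S e"] unfolding greenR_iff by simp
  then show 1: "e \<cdot> star S e \<in> PD" using e D_greenR friendlyD(1)[OF f] by (auto simp: PD_def)
  then show 2: "star S e \<cdot> e \<in> PD" using friendly_D[OF f] by blast
  have "star S e = star S e \<cdot> e \<cdot> (e \<cdot> star S e)"
    using idem_prod_proj[OF idem_star[OF e(1)]] c by (simp add: star_simps)
  then show "star S e \<in> E" using friendly_D(2)[OF friendly_sym[OF f] 2] by metis
qed

section \<open>Words in the presented group\<close>

definition grp_eq :: "('a \<times> bool) list \<Rightarrow> ('a \<times> bool) list \<Rightarrow> bool" (infix "\<approx>" 50) where
  "g \<approx> h \<longleftrightarrow> (g, h) \<in> word_cong (subgroup_rels S D T \<union> cancellation_rels E)"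

lemma grp_refl: "g \<approx> g"
  and grp_sym: "g \<approx> h \<Longrightarrow> h \<approx> g"
  and grp_trans [trans]: "\<lbrakk>g \<approx> h; h \<approx> k\<rbrakk> \<Longrightarrow> g \<approx> k"
  unfolding grp_eq_def by (blast intro: word_cong.intros)+

lemma grp_append: "\<lbrakk>g \<approx> g'; h \<approx> h'\<rbrakk> \<Longrightarrow> g @ h \<approx> g' @ h'"
  unfolding grp_eq_def by (rule word_cong_append)

lemma grp_context: "g \<approx> h \<Longrightarrow> x @ g @ y \<approx> x @ h @ y"
  unfolding grp_eq_def by (rule word_cong_context)

lemma grp_rels_cases [consumes 1, case_names tree star square cancel]:
  assumes "(g, h) \<in> subgroup_rels S D T \<union> cancellation_rels E"
  obtains e where "e \<in> T" "g = [(e, True)]" "h = []"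
  | e where "e \<in> E" "g = [(e, True)]" "h = [(star S e, False)]"
  | e f e' f' where "singular_square S e f e' f'" "e \<in> E" "f \<in> E" "e' \<in> E" "f' \<in> E"
      "g = [(e, False), (f, True)]" "h = [(e', False), (f', True)]"
  | e b where "e \<in> E" "g = [(e, b), (e, \<not> b)]" "h = []"
proof -
  have "(\<exists>e. e \<in> T \<and> g = [(e, True)] \<and> h = []) \<or>
    (\<exists>e. e \<in> E \<and> g = [(e, True)] \<and> h = [(star S e, False)]) \<or>
    (\<exists>e f e' f'. singular_square S e f e' f' \<and> {e, f, e', f'} \<subseteq> D \<and>
      g = [(e, False), (f, True)] \<and> h = [(e', False), (f', True)]) \<or>
    (\<exists>e b. e \<in> E \<and> g = [(e, b), (e, \<not> b)] \<and> h = [])"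
    using assms unfolding subgroup_rels_def cancellation_rels_def E_def
    by (elim UnE CollectE exE conjE Pair_inject) blast+
  then show thesis
  proof (elim disjE exE conjE)
    fix e f e' f'
    assume sq: "singular_square S e f e' f'" "{e, f, e', f'} \<subseteq> D"
      "g = [(e, False), (f, True)]" "h = [(e', False), (f', True)]"
    then have "{e, f, e', f'} \<subseteq> E"
      by (auto simp: singular_square_def is_square_def E_def)
    then show thesis using sq that(3) by blast
  qed (use that in blast)+
qed

lemma grp_lists:
  assumes "g \<approx> h"
  shows "g \<in> lists (E \<times> UNIV) \<longleftrightarrow> h \<in> lists (E \<times> UNIV)"
  using assms unfolding grp_eq_def
proof (rule word_cong_lists)
  fix g h assume "(g, h) \<in> subgroup_rels S D T \<union> cancellation_rels E"
  then show "g \<in> lists (E \<times> UNIV) \<longleftrightarrow> h \<in> lists (E \<times> UNIV)"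
    by (cases rule: grp_rels_cases) (use T_E E_proj(3) in auto)
qed

lemma grp_base: "(g, h) \<in> subgroup_rels S D T \<union> cancellation_rels E \<Longrightarrow> g \<approx> h"
  unfolding grp_eq_def by (rule word_cong_base)

lemma grp_tree: "e \<in> T \<Longrightarrow> [(e, True)] \<approx> []"
  by (rule grp_base) (simp add: subgroup_rels_def)

lemma grp_cancel: "e \<in> E \<Longrightarrow> [(e, b), (e, \<not> b)] \<approx> []"
  by (rule grp_base) (auto simp: cancellation_rels_def)

lemma grp_star: "e \<in> E \<Longrightarrow> [(e, True)] \<approx> [(star S e, False)]"
  by (rule grp_base) (unfold subgroup_rels_def E_def, blast)

lemma grp_star': "e \<in> E \<Longrightarrow> [(e, False)] \<approx> [(star S e, True)]"
  using grp_sym[OF grp_star[OF E_proj(3)], of e] E_proj(4)[of e] by (simp add: star_star)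

lemma grp_square:
  "\<lbrakk>singular_square S e f g h; {e, f, g, h} \<subseteq> E\<rbrakk> \<Longrightarrow> [(e, False), (f, True)] \<approx> [(g, False), (h, True)]"
  by (rule grp_base) (unfold subgroup_rels_def E_def, blast)

text \<open>\<open>s \<cdot> t\<close> and \<open>t \<cdot> s\<close> are each other's star, so the
  star relation makes a step and its reverse inverse.\<close>

lemma grp_inverse_pair:
  assumes "friendly s t" "s \<in> PD"
  shows "[(s \<cdot> t, True), (t \<cdot> s, True)] \<approx> []" "[(s \<cdot> t, False)] \<approx> [(t \<cdot> s, True)]"
proof -
  note f = friendly_D[OF assms]
  show "[(s \<cdot> t, False)] \<approx> [(t \<cdot> s, True)]"
    using grp_star'[OF f(2)] friendly_prod(4)[OF assms(1)] by simp
  then have "[(s \<cdot> t, True)] @ [(t \<cdot> s, True)] \<approx> [(s \<cdot> t, True)] @ [(s \<cdot> t, False)]"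
    by (intro grp_append[OF grp_refl grp_sym])
  also have "\<dots> \<approx> []" using grp_cancel[OF f(2), of True] by simp
  finally show "[(s \<cdot> t, True), (t \<cdot> s, True)] \<approx> []" by simp
qed

text \<open>The square relation freed of formal inverses: a passage from \<open>c\<close> to
  \<open>d\<close> through \<open>s\<close> may run through \<open>p s p\<close> instead.\<close>

lemma grp_square_conj:
  assumes s: "s \<in> PD" and p: "p \<in> projections S" and sps: "s \<cdot> (p \<cdot> s) = s"
    and sc: "friendly s c" and sd: "friendly s d" and cp: "c \<cdot> p = c" and dp: "d \<cdot> p = d"
  shows "[(c \<cdot> s, True), (s \<cdot> d, True)] \<approx> [(c \<cdot> (p \<cdot> (s \<cdot> p)), True), (p \<cdot> (s \<cdot> p) \<cdot> d, True)]"
proof -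
  let ?t = "p \<cdot> (s \<cdot> p)"
  note sS = PD_proj[OF s]
  note tc = friendly_step(1)[OF sS p sps sc cp] and td = friendly_step(1)[OF sS p sps sd dp]
  have t: "?t \<in> PD" using friendly_D(1)[OF friendly_conj(1)[OF sS p sps] s] .
  have "[(c \<cdot> s, True)] @ [(s \<cdot> d, True)] \<approx> [(s \<cdot> c, False)] @ [(s \<cdot> d, True)]"
    using grp_inverse_pair(2)[OF sc s] by (intro grp_append[OF grp_sym grp_refl])
  also have "\<dots> \<approx> [(?t \<cdot> c, False), (?t \<cdot> d, True)]"
    using grp_square[OF singular_square_conj[OF sS p sps sc sd cp dp]]
      friendly_D(2)[OF sc s] friendly_D(2)[OF sd s] friendly_D(2)[OF tc t] friendly_D(2)[OF td t] by simp
  also have "\<dots> = [(?t \<cdot> c, False)] @ [(?t \<cdot> d, True)]" by simp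
  also have "\<dots> \<approx> [(c \<cdot> ?t, True)] @ [(?t \<cdot> d, True)]"
    using grp_inverse_pair(2)[OF tc t] by (intro grp_append grp_refl)
  finally show ?thesis by simp
qed

text \<open>Follows a word \<open>w\<close> through the \<open>\<L>\<close>-classes of the prefixes of \<open>s w\<close> and records the
  idempotents that label the steps.\<close>

primrec labels :: "'a \<Rightarrow> 'a list \<Rightarrow> ('a \<times> bool) list" where
  "labels s [] = []"
| "labels s (p # w) = (s \<cdot> p, True) # labels (p \<cdot> (s \<cdot> p)) w"

lemma labels_append: "labels s (u @ v) = labels s u @ labels (act s u) v"
  by (induction u arbitrary: s) auto

lemma act_PD: "\<lbrakk>s \<in> PD; w \<in> lists (projections S); stays s w\<rbrakk> \<Longrightarrow> act s w \<in> PD"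
proof (induction w arbitrary: s)
  case (Cons p w)
  then have "p \<cdot> (s \<cdot> p) \<in> PD"
    using friendly_D(1)[OF friendly_conj(1)] PD_proj by auto
  then show ?case using Cons by auto
qed simp

lemma labels_lists:
  "\<lbrakk>s \<in> PD; w \<in> lists (projections S); stays s w\<rbrakk> \<Longrightarrow> labels s w \<in> lists (E \<times> UNIV)"
proof (induction w arbitrary: s)
  case (Cons p w)
  then have s: "s \<in> projections S" "p \<in> projections S" "s \<cdot> (p \<cdot> s) = s" using PD_proj by auto
  then have "s \<cdot> p \<in> E" "p \<cdot> (s \<cdot> p) \<in> PD"
    using friendly_D[OF friendly_conj(1)[OF s] Cons.prems(1)] friendly_conj(2)[OF s] by simp_all
  then show ?case using Cons by auto
qed simp

text \<open>The surplus label for \<open>p p\<close> is a projection in \<open>D\<close>, hence in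
  \<open>T\<close>; the surplus labels for \<open>p q p q\<close> are a step and its reverse;
  \<open>p q p\<close> needs two squares.\<close>

lemma labels_rel:
  assumes "(u, v) \<in> PG_rels P" and s: "s \<in> PD" and stays: "stays s u"
  shows "labels s u \<approx> labels s v"
  using assms(1)
proof (cases rule: PG_rels_cases)
  case (idem p)
  note sS = PD_proj[OF s]
  have sps: "s \<cdot> (p \<cdot> s) = s" using stays idem by simp
  have "p \<cdot> (s \<cdot> p) \<in> PD" using friendly_D(1)[OF friendly_conj(1)[OF sS idem(1) sps] s] .
  moreover have "p \<cdot> (s \<cdot> p) \<cdot> p = p \<cdot> (s \<cdot> p)"
    using projD[OF sS] projD[OF idem(1)] by (simp add: star_simps)
  ultimately have "[(p \<cdot> (s \<cdot> p) \<cdot> p, True)] \<approx> []" using PD_T grp_tree by simp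
  from grp_append[OF grp_refl[of "[(s \<cdot> p, True)]"] this] show ?thesis using idem by simp
next
  case (square p q)
  note sS = PD_proj[OF s]
  define t where "t = p \<cdot> (s \<cdot> p)"
  define u1 where "u1 = q \<cdot> (t \<cdot> q)"
  define v1 where "v1 = p \<cdot> (u1 \<cdot> p)"
  have st: "s \<cdot> (p \<cdot> s) = s" "t \<cdot> (q \<cdot> t) = t" "u1 \<cdot> (p \<cdot> u1) = u1" "v1 \<cdot> (q \<cdot> v1) = v1"
    using stays square by (simp_all add: t_def u1_def v1_def)
  have PDs: "t \<in> PD" unfolding t_def by (rule conj_PD[OF s square(1) st(1)])
  have PDs: "t \<in> PD" "u1 \<in> PD"
    using PDs conj_PD[OF PDs square(2) st(2)] by (simp_all add: u1_def)
  have PDs: "t \<in> PD" "u1 \<in> PD" "v1 \<in> PD"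
    using PDs conj_PD[OF PDs(2) square(1) st(3)] by (simp_all add: v1_def)
  \<comment> \<open>Both sides of the relation end at the same label, so the fourth letter leads
    back from \<open>v1\<close> to \<open>u1\<close>.\<close>
  have "q \<cdot> (v1 \<cdot> q) = u1"
    using pg_act_stays[OF pg_base[OF assms(1)] sS] square by (simp add: t_def u1_def v1_def)
  then have "friendly v1 u1" "v1 \<cdot> u1 = v1 \<cdot> q"
    using friendly_conj[OF PD_proj[OF PDs(3)] square(2) st(4)] by simp_all
  moreover have "u1 \<cdot> v1 = u1 \<cdot> p"
    using friendly_conj[OF PD_proj[OF PDs(2)] square(1) st(3)] by (simp add: v1_def)
  ultimately have "[(u1 \<cdot> p, True), (v1 \<cdot> q, True)] \<approx> []"
    using grp_inverse_pair(1)[OF friendly_sym PDs(2), of v1] by simp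
  from grp_append[OF grp_refl[of "[(s \<cdot> p, True), (t \<cdot> q, True)]"] this]
  show ?thesis using square by (simp add: t_def u1_def v1_def)
next
  case (conj p q)
  note sS = PD_proj[OF s]
  define t where "t = p \<cdot> (s \<cdot> p)"
  define u1 where "u1 = q \<cdot> (t \<cdot> q)"
  define v1 where "v1 = p \<cdot> (u1 \<cdot> p)"
  let ?m = "p \<cdot> (q \<cdot> p)"
  have st: "s \<cdot> (p \<cdot> s) = s" "t \<cdot> (q \<cdot> t) = t" "u1 \<cdot> (p \<cdot> u1) = u1"
    using stays conj by (simp_all add: t_def u1_def v1_def)
  have PDs: "t \<in> PD" unfolding t_def by (rule conj_PD[OF s conj(1) st(1)])
  have PDs: "t \<in> PD" "u1 \<in> PD"
    using PDs conj_PD[OF PDs conj(2) st(2)] by (simp_all add: u1_def)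
  have PDs: "t \<in> PD" "u1 \<in> PD" "v1 \<in> PD"
    using PDs conj_PD[OF PDs(2) conj(1) st(3)] by (simp_all add: v1_def)
  note as = pg_act_stays[OF pg_base[OF assms(1)] sS]
  have m: "s \<cdot> (?m \<cdot> s) = s" "?m \<cdot> (s \<cdot> ?m) = v1"
    using as conj stays by (simp_all add: t_def u1_def v1_def)
  have sv: "friendly s v1" "s \<cdot> v1 = s \<cdot> ?m"
    using friendly_conj[OF sS proj_conj[OF conj(1,2)] m(1)] m(2) by simp_all
  have st': "friendly s t" "s \<cdot> t = s \<cdot> p"
    using friendly_conj[OF sS conj(1) st(1)] by (simp_all add: t_def)
  have tu: "friendly t u1" "t \<cdot> u1 = t \<cdot> q"
    using friendly_conj[OF PD_proj[OF PDs(1)] conj(2) st(2)] by (simp_all add: u1_def)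
  have uv: "friendly u1 v1" "u1 \<cdot> v1 = u1 \<cdot> p"
    using friendly_conj[OF PD_proj[OF PDs(2)] conj(1) st(3)] by (simp_all add: v1_def)
  have tp: "t \<cdot> p = t" "v1 \<cdot> p = v1"
    using projD[OF sS] projD[OF conj(1)] projD[OF PD_proj[OF PDs(2)]]
    by (simp_all add: t_def v1_def star_simps)
  have idem: "t \<cdot> t = t" "v1 \<cdot> v1 = v1" using PDs PD_proj projD(2) by auto
  have tT: "[(t, True)] \<approx> []" and vT: "[(v1, True)] \<approx> []" using PDs PD_T grp_tree by auto
  \<comment> \<open>Square with rows \<open>u1\<close>, \<open>v1\<close> and columns
    \<open>t\<close>, \<open>v1\<close>; its corner \<open>v1\<close> is trivial.\<close>
  have "[(t \<cdot> u1, True), (u1 \<cdot> v1, True)] \<approx> [(t \<cdot> v1, True), (v1 \<cdot> v1, True)]"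
    using grp_square_conj[OF PDs(2) conj(1) st(3) friendly_sym[OF tu(1)] uv(1) tp]
    by (simp add: v1_def[symmetric])
  also have "\<dots> = [(t \<cdot> v1, True)] @ [(v1, True)]" by (simp add: idem)
  also have "\<dots> \<approx> [(t \<cdot> v1, True)] @ []" by (intro grp_append grp_refl vT)
  finally have 1: "[(t \<cdot> u1, True), (u1 \<cdot> v1, True)] \<approx> [(t \<cdot> v1, True)]" by simp
  \<comment> \<open>Square with rows \<open>s\<close>, \<open>t\<close> and columns
    \<open>t\<close>, \<open>v1\<close>; its corner \<open>t\<close> is trivial.\<close>
  have "[(t \<cdot> s, True), (s \<cdot> v1, True)] \<approx> [(t \<cdot> t, True), (t \<cdot> v1, True)]"
    using grp_square_conj[OF s conj(1) st(1) st'(1) sv(1) tp] by (simp add: t_def[symmetric])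
  also have "\<dots> = [(t, True)] @ [(t \<cdot> v1, True)]" by (simp add: idem)
  also have "\<dots> \<approx> [] @ [(t \<cdot> v1, True)]" by (intro grp_append grp_refl tT)
  finally have 2: "[(t \<cdot> s, True), (s \<cdot> v1, True)] \<approx> [(t \<cdot> v1, True)]" by simp
  \<comment> \<open>The path \<open>s, t, u1, v1\<close> is traded for \<open>s, t, s, v1\<close>,
    whose first two steps cancel.\<close>
  have "[(s \<cdot> t, True)] @ [(t \<cdot> u1, True), (u1 \<cdot> v1, True)] \<approx> [(s \<cdot> t, True)] @ [(t \<cdot> s, True), (s \<cdot> v1, True)]"
    by (intro grp_append grp_refl grp_trans[OF 1 grp_sym[OF 2]])
  also have "\<dots> = [(s \<cdot> t, True), (t \<cdot> s, True)] @ [(s \<cdot> v1, True)]" by simp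
  also have "\<dots> \<approx> [] @ [(s \<cdot> v1, True)]"
    by (intro grp_append grp_refl grp_inverse_pair(1)[OF st'(1) s])
  finally show ?thesis
    using conj st' tu uv sv by (simp add: t_def u1_def v1_def)
qed

lemma labels_cong:
  assumes "u \<simeq> v" "s \<in> PD" "u \<in> lists (projections S)" "stays s u"
  shows "labels s u \<approx> labels s v"
  using assms unfolding pg_eq_def
proof (induction arbitrary: s)
  case (rel u v x y)
  define s' where "s' = act s x"
  have l: "x \<in> lists (projections S)" "u \<in> lists (projections S)" "stays s x" "stays s' u"
    using rel by (auto simp: stays_append s'_def)
  have s': "s' \<in> PD" unfolding s'_def using act_PD[OF rel(2) l(1,3)] .
  have "labels s' u \<approx> labels s' v" using labels_rel[OF rel(1) s' l(4)] .
  moreover have "act s' u = act s' v" using pg_act_stays[OF pg_base[OF rel(1)] PD_proj[OF s'] l(2)] ..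
  ultimately show ?case by (simp add: labels_append s'_def[symmetric] grp_context)
next
  case (sym u v)
  note uv = sym.hyps[folded pg_eq_def]
  have "u \<in> lists (projections S)" using pg_lists[OF uv] sym.prems(2) by blast
  moreover from this have "stays s u"
    using pg_act_stays[OF uv PD_proj[OF sym.prems(1)]] sym.prems(3) by blast
  ultimately show ?case using sym.IH sym.prems(1) grp_sym by blast
next
  case (trans u v w)
  note uv = trans.hyps(1)[folded pg_eq_def]
  have "v \<in> lists (projections S)" using pg_lists[OF uv] trans.prems(2) by blast
  moreover have "stays s v"
    using pg_act_stays[OF uv PD_proj[OF trans.prems(1)] trans.prems(2)] trans.prems(3) by blast
  ultimately show ?case using trans.IH trans.prems grp_trans by blast
qed (rule grp_refl)

text \<open>\<open>w @ rev w\<close> is equivalent to \<open>[s]\<close>, whose only label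
  \<open>s\<close> lies in \<open>T\<close>, so the labels of \<open>rev w\<close> invert those of
  \<open>w\<close>.\<close>

lemma labels_rev_trivial:
  assumes "arrow s w t" "s \<in> PD" "labels s w \<approx> []"
  shows "labels t (rev w) \<approx> []"
proof -
  note a = arrowD[OF assms(1)] and st = arrow_stays[OF assms(1)]
  have "stays s (w @ rev w)"
    using pg_act_stays[OF a(5) a(1)] a(1,3) by (simp add: projD)
  then have "labels s (w @ rev w) \<approx> labels s [s]"
    using a assms by (intro labels_cong) auto
  also have "labels s [s] = [(s, True)]" using a by (simp add: projD)
  also have "\<dots> \<approx> []" using assms(2) by (intro grp_tree PD_T)
  finally have 1: "labels s w @ labels t (rev w) \<approx> []" by (simp add: labels_append st)
  have "[] @ labels t (rev w) \<approx> labels s w @ labels t (rev w)"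
    by (intro grp_append grp_refl grp_sym[OF assms(3)])
  from grp_trans[OF this 1] show ?thesis by simp
qed

lemma arrow_cong:
  assumes "arrow s u t" and uv: "u \<simeq> v"
  shows "arrow s v t"
proof -
  note a = arrowD[OF assms(1)]
  have "v @ rev v \<simeq> [s]" "rev v @ v \<simeq> [t]"
    using pg_trans[OF pg_append[OF pg_sym[OF uv] pg_rev[OF pg_sym[OF uv]]] a(5)]
      pg_trans[OF pg_append[OF pg_rev[OF pg_sym[OF uv]] pg_sym[OF uv]] a(6)] by simp_all
  then show ?thesis using a pg_lists[OF uv] pg_Nil_iff[OF uv] by (simp add: arrow_def)
qed

section \<open>Tree words\<close>

text \<open>The choice of \<open>x\<close> is immaterial: by \<open>greenR_iff\<close> and
  \<open>greenL_iff\<close> the products are constant on the classes.\<close>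

fun vertex_proj :: "'a set + 'a set \<Rightarrow> 'a" where
  "vertex_proj (Inl R) = (let x = SOME x. x \<in> R in x \<cdot> star S x)"
| "vertex_proj (Inr L) = (let x = SOME x. x \<in> L in star S x \<cdot> x)"

lemma vertex_proj_class:
  assumes "e \<in> carrier S"
  shows "vertex_proj (Inl (greenR S `` {e})) = e \<cdot> star S e"
    and "vertex_proj (Inr (greenL S `` {e})) = star S e \<cdot> e"
proof -
  have "e \<in> greenR S `` {e}" "e \<in> greenL S `` {e}" using assms by (auto simp: greenR_iff greenL_iff)
  then have "(SOME x. x \<in> greenR S `` {e}) \<in> greenR S `` {e}" "(SOME x. x \<in> greenL S `` {e}) \<in> greenL S `` {e}"
    using someI[of "\<lambda>x. x \<in> greenR S `` {e}" e] someI[of "\<lambda>x. x \<in> greenL S `` {e}" e] by blast+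
  then show "vertex_proj (Inl (greenR S `` {e})) = e \<cdot> star S e"
    "vertex_proj (Inr (greenL S `` {e})) = star S e \<cdot> e"
    by (auto simp: Let_def greenR_iff greenL_iff)
qed

text \<open>The tree seen on projections: the \<R>-vertex and the \<L>-vertex of a projection merge,
  and the edge between them becomes a loop.\<close>

definition adjacent :: "'a \<Rightarrow> 'a \<Rightarrow> bool" where
  "adjacent s t \<longleftrightarrow> (\<exists>e\<in>T. s = e \<cdot> star S e \<and> t = star S e \<cdot> e \<or> s = star S e \<cdot> e \<and> t = e \<cdot> star S e)"

lemma adjacentD:
  assumes "adjacent s t"
  shows "s \<in> PD" "t \<in> PD" "friendly s t" "[(s \<cdot> t, True)] \<approx> []"
proof -
  obtain e where e: "e \<in> T" "s = e \<cdot> star S e \<and> t = star S e \<cdot> e \<or> s = star S e \<cdot> e \<and> t = e \<cdot> star S e"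
    using assms by (auto simp: adjacent_def)
  then have eE: "e \<in> E" using T_E by auto
  note ep = E_proj[OF eE]
  show st: "s \<in> PD" "t \<in> PD" "friendly s t" using e(2) ep friendly_sym by auto
  show "[(s \<cdot> t, True)] \<approx> []"
  proof (cases "s = e \<cdot> star S e \<and> t = star S e \<cdot> e")
    case True
    then show ?thesis using ep e grp_tree by simp
  next
    case False
    then have eq: "t \<cdot> s = e" using e ep by auto
    have "[] @ [(s \<cdot> t, True)] \<approx> [(t \<cdot> s, True)] @ [(s \<cdot> t, True)]"
      using grp_tree[OF e(1)] eq by (intro grp_append[OF grp_sym grp_refl]) simp
    also have "\<dots> \<approx> []" using grp_inverse_pair(1)[OF friendly_sym[OF st(3)] st(2)] by simp
    finally show ?thesis by simp
  qed
qed

text \<open>Every step is labelled by an element of \<open>T\<close> or by the star of one, and the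
  first letter by \<open>p0\<close>, which is in \<open>T\<close> too.\<close>

lemma adjacent_walk:
  assumes "ps \<noteq> []" "hd ps = p0" "successively adjacent ps"
  shows "last ps \<in> PD \<and> arrow p0 ps (last ps) \<and> labels p0 ps \<approx> []"
  using assms
proof (induction ps rule: rev_induct)
  case (snoc q ps)
  show ?case
  proof (cases "ps = []")
    case True
    then have "q = p0" using snoc by simp
    then show ?thesis
      using True p0_PD arrow_proj[OF p0] grp_tree[OF PD_T[OF p0_PD]] projD[OF p0] by simp
  next
    case False
    define s where "s = last ps"
    have IH: "s \<in> PD" "arrow p0 ps s" "labels p0 ps \<approx> []" and adj: "adjacent s q"
      using snoc False by (auto simp: successively_append_iff s_def)
    note a = adjacentD[OF adj]
    have "arrow p0 (ps @ [s, q]) q" using arrow_append[OF IH(2) arrow_friendly[OF a(3)]] .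
    moreover have "ps @ [s, q] \<simeq> ps @ [q]"
      using pg_append[OF arrow_absorb(2)[OF IH(2)] pg_refl[of "[q]"]] by simp
    ultimately have "arrow p0 (ps @ [q]) q" by (rule arrow_cong)
    moreover have "labels p0 (ps @ [q]) \<approx> []"
      using grp_append[OF IH(3) a(4)] arrow_stays(2)[OF IH(2)] by (simp add: labels_append)
    ultimately show ?thesis using a by simp
  qed
qed simp

lemma tree_edge_adjacent:
  assumes "{u, v} \<in> GH_edge S ` T"
  shows "adjacent (vertex_proj u) (vertex_proj v)"
proof -
  obtain e where e: "e \<in> T" "{u, v} = {Inl (greenR S `` {e}), Inr (greenL S `` {e})}"
    using assms by (auto simp: GH_edge_def)
  have "e \<in> carrier S" using e T_E E_proj(4) by auto
  note vp = vertex_proj_class[OF this]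
  show ?thesis using e vp unfolding adjacent_def by (auto simp: doubleton_eq_iff)
qed

lemma greenR_class_proj: "e \<in> carrier S \<Longrightarrow> greenR S `` {e \<cdot> star S e} = greenR S `` {e}"
  and greenL_class_proj: "e \<in> carrier S \<Longrightarrow> greenL S `` {star S e \<cdot> e} = greenL S `` {e}"
  using projD[OF prod_star_proj[of e]] projD[OF star_prod_proj[of e]]
  by (auto simp: greenR_iff greenL_iff)

text \<open>The words are read off the root paths of the tree. The last clause is what makes the
  loop of a tree edge trivial.\<close>

lemma tree_words:
  "\<exists>t. t p0 = [p0] \<and> (\<forall>q\<in>PD. arrow p0 (t q) q \<and> labels p0 (t q) \<approx> []) \<and>
     (\<forall>e\<in>T. t (e \<cdot> star S e) @ [star S e \<cdot> e] \<simeq> t (star S e \<cdot> e))"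
proof -
  let ?V = "GH_verts S D" and ?F = "GH_edge S ` T"
  define root where "root = (Inl (greenR S `` {p0}) :: 'a set + 'a set)"
  have verts: "Inl (greenR S `` {e}) \<in> ?V" "Inr (greenL S `` {e}) \<in> ?V" if "e \<in> D" for e
    using that by (auto simp: GH_verts_def intro: quotientI)
  have "is_tree ?V ?F" using spanning_tree by (simp add: GH_spanning_tree_def is_spanning_tree_def)
  then obtain \<pi> where \<pi>: "\<pi> root = [root]"
    "\<And>v. v \<in> ?V \<Longrightarrow> is_walk ?F (\<pi> v) \<and> hd (\<pi> v) = root \<and> last (\<pi> v) = v"
    "\<And>u v. \<lbrakk>u \<in> ?V; v \<in> ?V; u \<noteq> v; {u, v} \<in> ?F\<rbrakk> \<Longrightarrow> \<pi> v = \<pi> u @ [v] \<or> \<pi> u = \<pi> v @ [u]"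
    using tree_paths[of ?V ?F root] verts(1)[OF p0_D, folded root_def] by blast
  define wd where "wd v = map vertex_proj (\<pi> v)" for v
  have root: "vertex_proj root = p0"
    using vertex_proj_class(1) projD[OF p0] by (simp add: root_def)
  have wd: "vertex_proj v \<in> PD" "arrow p0 (wd v) (vertex_proj v)" "labels p0 (wd v) \<approx> []"
    if v: "v \<in> ?V" for v
  proof -
    have w: "\<pi> v \<noteq> []" "hd (\<pi> v) = root" "last (\<pi> v) = v" "successively (\<lambda>u v. {u, v} \<in> ?F) (\<pi> v)"
      using \<pi>(2)[OF v] by (auto simp: is_walk_def)
    have "successively adjacent (wd v)"
      unfolding wd_def successively_map
      using w(4) by (rule successively_mono) (rule tree_edge_adjacent)
    then show "vertex_proj v \<in> PD" "arrow p0 (wd v) (vertex_proj v)" "labels p0 (wd v) \<approx> []"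
      using adjacent_walk[of "wd v"] w root by (auto simp: wd_def hd_map last_map)
  qed
  have edge: "wd u @ [vertex_proj v] \<simeq> wd v" if uv: "u \<in> ?V" "v \<in> ?V" "u \<noteq> v" "{u, v} \<in> ?F" for u v
    using \<pi>(3)[OF uv]
  proof
    assume "\<pi> v = \<pi> u @ [v]"
    then show ?thesis by (simp add: wd_def pg_refl)
  next
    let ?s = "vertex_proj u" and ?t = "vertex_proj v"
    \<comment> \<open>Here the path to \<open>u\<close> already runs through \<open>v\<close>;
      stepping back to \<open>v\<close> cancels, since \<open>[?t, ?s, ?t]\<close> collapses to
      \<open>[?t]\<close>.\<close>
    assume "\<pi> u = \<pi> v @ [u]"
    then have "wd u = wd v @ [?s]" by (simp add: wd_def)
    then have "wd u @ [?t] = wd v @ [?s, ?t]" by simp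
    also have "\<dots> \<simeq> (wd v @ [?t]) @ [?s, ?t]"
      by (intro pg_append pg_sym[OF arrow_absorb(2)[OF wd(2)[OF uv(2)]]] pg_refl)
    also have "\<dots> = wd v @ [?t, ?s, ?t]" by simp
    also have "\<dots> \<simeq> wd v @ [?t]"
    proof -
      have "friendly ?s ?t" using adjacentD(3)[OF tree_edge_adjacent[OF uv(4)]] .
      then have "[?t, ?s, ?t] \<simeq> [?t]" using pg_conj[of ?t ?s "[]"] friendlyD[of ?s ?t] by simp
      then show ?thesis by (intro pg_append pg_refl)
    qed
    also have "\<dots> \<simeq> wd v" by (rule arrow_absorb(2)[OF wd(2)[OF uv(2)]])
    finally show ?thesis .
  qed
  define t where "t q = wd (Inl (greenR S `` {q}))" for q
  have "t p0 = [p0]" using \<pi>(1) root by (simp add: t_def wd_def root_def)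
  moreover have "arrow p0 (t q) q \<and> labels p0 (t q) \<approx> []" if "q \<in> PD" for q
  proof -
    have "q \<in> D" "vertex_proj (Inl (greenR S `` {q})) = q"
      using that vertex_proj_class(1)[of q] projD[OF PD_proj[OF that]] by (auto simp: PD_def)
    then show ?thesis using wd(2,3)[OF verts(1), of q] unfolding t_def by (metis)
  qed
  moreover have "t (e \<cdot> star S e) @ [star S e \<cdot> e] \<simeq> t (star S e \<cdot> e)" if e: "e \<in> T" for e
  proof -
    have eE: "e \<in> E" using e T_E by auto
    note ep = E_proj[OF eE]
    let ?q = "star S e \<cdot> e"
    let ?a = "Inl (greenR S `` {e}) :: 'a set + 'a set" and ?b = "Inr (greenL S `` {e}) :: 'a set + 'a set"
      and ?c = "Inl (greenR S `` {?q}) :: 'a set + 'a set"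
    have V: "?a \<in> ?V" "?b \<in> ?V" "?c \<in> ?V" using verts eE ep by (auto simp: E_def PD_def)
    \<comment> \<open>\<open>t\<close> uses \<R>-vertices only. From the \<L>-vertex of
      \<open>e\<close>, the \<R>-vertex of \<open>?q\<close> is reached along the edge of
      \<open>?q\<close>, which is in \<open>T\<close> as all projections in \<open>D\<close>
      are.\<close>
    have "?q \<in> T" using ep PD_T by blast
    moreover have "{?b, ?c} = GH_edge S ?q"
      using greenL_class_proj[OF ep(4)] by (simp add: GH_edge_def insert_commute)
    ultimately have F: "{?a, ?b} \<in> ?F" "{?b, ?c} \<in> ?F" using e by (auto simp: GH_edge_def)
    have vp: "vertex_proj ?b = ?q" "vertex_proj ?c = ?q"
      using vertex_proj_class(2)[OF ep(4)] vertex_proj_class(1)[of ?q] projD[OF PD_proj[OF ep(2)]]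
      by simp_all
    have "wd ?a @ [?q] \<simeq> wd ?b" using edge[OF V(1,2) _ F(1)] vp by simp
    also have "\<dots> \<simeq> wd ?b @ [?q]" using pg_sym[OF arrow_absorb(2)[OF wd(2)[OF V(2)]]] vp by simp
    also have "\<dots> \<simeq> wd ?c" using edge[OF V(2,3) _ F(2)] vp by simp
    finally show ?thesis using greenR_class_proj[OF ep(4)] by (simp add: t_def)
  qed
  ultimately show ?thesis by blast
qed

definition tree_word :: "'a \<Rightarrow> 'a list" where
  "tree_word = (SOME t. t p0 = [p0] \<and> (\<forall>q\<in>PD. arrow p0 (t q) q \<and> labels p0 (t q) \<approx> []) \<and>
     (\<forall>e\<in>T. t (e \<cdot> star S e) @ [star S e \<cdot> e] \<simeq> t (star S e \<cdot> e)))"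

lemma tree_word_root: "tree_word p0 = [p0]"
  and tree_word_arrow: "q \<in> PD \<Longrightarrow> arrow p0 (tree_word q) q"
  and tree_word_labels: "q \<in> PD \<Longrightarrow> labels p0 (tree_word q) \<approx> []"
  and tree_word_edge: "e \<in> T \<Longrightarrow> tree_word (e \<cdot> star S e) @ [star S e \<cdot> e] \<simeq> tree_word (star S e \<cdot> e)"
  using someI_ex[OF tree_words] unfolding tree_word_def[symmetric] by blast+

end

section \<open>The inverse map\<close>

context subgroup_presentation
begin

primrec lift_letter :: "'a \<times> bool \<Rightarrow> 'a list" where
  "lift_letter (e, b) =
     (let r = e \<cdot> star S e; c = star S e \<cdot> e; w = tree_word r @ [r, c] @ rev (tree_word c)
      in if b then w else rev w)"

declare lift_letter.simps [simp del]

lemma lift_letter_True: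
  "lift_letter (e, True) = tree_word (e \<cdot> star S e) @ [e \<cdot> star S e, star S e \<cdot> e] @ rev (tree_word (star S e \<cdot> e))"
  and lift_letter_False:
  "lift_letter (e, False) = tree_word (star S e \<cdot> e) @ [star S e \<cdot> e, e \<cdot> star S e] @ rev (tree_word (e \<cdot> star S e))"
  by (simp_all add: lift_letter.simps Let_def)

text \<open>The empty product is \<open>[p0]\<close>, not the empty word: it represents the identity
  of the maximal subgroup.\<close>

primrec lift_word :: "('a \<times> bool) list \<Rightarrow> 'a list" where
  "lift_word [] = [p0]"
| "lift_word (x # g) = lift_letter x @ lift_word g"

lemma lift_letter_arrow:
  assumes "e \<in> E"
  shows "arrow p0 (lift_letter (e, b)) p0"
proof -
  note ep = E_proj[OF assms]
  let ?r = "e \<cdot> star S e" and ?c = "star S e \<cdot> e"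
  note arrs = tree_word_arrow[OF ep(1)] tree_word_arrow[OF ep(2)]
  show ?thesis
  proof (cases b)
    case True
    then show ?thesis
      using arrow_append[OF arrs(1) arrow_append[OF arrow_friendly[OF ep(5)] arrow_rev[OF arrs(2)]]]
      by (simp add: lift_letter_True)
  next
    case False
    then show ?thesis
      using arrow_append[OF arrs(2) arrow_append[OF arrow_friendly[OF friendly_sym[OF ep(5)]]
            arrow_rev[OF arrs(1)]]]
      by (simp add: lift_letter_False)
  qed
qed

lemma lift_word_arrow: "g \<in> lists (E \<times> UNIV) \<Longrightarrow> arrow p0 (lift_word g) p0"
  by (induction g) (auto intro: arrow_proj[OF p0] arrow_append lift_letter_arrow)

lemma lift_word_append:
  assumes "h \<in> lists (E \<times> UNIV)"
  shows "lift_word (g @ h) \<simeq> lift_word g @ lift_word h"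
proof (induction g)
  case Nil
  show ?case using pg_sym[OF arrow_absorb(1)[OF lift_word_arrow[OF assms]]] by simp
next
  case (Cons x g)
  then show ?case using pg_append[OF pg_refl] by simp
qed

lemma lift_word_singleton: "e \<in> E \<Longrightarrow> lift_word [(e, b)] \<simeq> lift_letter (e, b)"
  using arrow_absorb(2)[OF lift_letter_arrow] by simp

text \<open>As \<open>e\<close> and \<open>f\<close> share a row, the return along the tree and the
  next way out cancel.\<close>

lemma lift_letter_False_True:
  assumes "e \<in> E" "f \<in> E" "e \<cdot> star S e = f \<cdot> star S f"
  shows "lift_word [(e, False), (f, True)] \<simeq>
    tree_word (star S e \<cdot> e) @ [star S e \<cdot> e, e \<cdot> star S e, star S f \<cdot> f] @ rev (tree_word (star S f \<cdot> f))"
proof -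
  note ep = E_proj[OF assms(1)] and fp = E_proj[OF assms(2)]
  define r c d where "r = e \<cdot> star S e" and "c = star S e \<cdot> e" and "d = star S f \<cdot> f"
  have rP: "r \<in> PD" using ep by (simp add: r_def)
  note ra = tree_word_arrow[OF rP]
  have "lift_word [(e, False), (f, True)] = lift_letter (e, False) @ (lift_letter (f, True) @ [p0])" by simp
  also have "\<dots> \<simeq> lift_letter (e, False) @ lift_letter (f, True)"
    by (intro pg_append pg_refl arrow_absorb(2)[OF lift_letter_arrow[OF assms(2)]])
  also have "\<dots> = (tree_word c @ [c, r]) @ (rev (tree_word r) @ tree_word r) @ ([r, d] @ rev (tree_word d))"
    using assms(3) by (simp add: lift_letter_True lift_letter_False r_def c_def d_def)
  also have "\<dots> \<simeq> (tree_word c @ [c, r]) @ [r] @ ([r, d] @ rev (tree_word d))"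
    by (rule pg_context[OF arrowD(6)[OF ra]])
  also have "\<dots> = (tree_word c @ [c]) @ (r # r # r # d # rev (tree_word d))" by simp
  also have "\<dots> \<simeq> (tree_word c @ [c]) @ (r # r # d # rev (tree_word d))"
    using PD_proj[OF rP] by (intro pg_append pg_refl pg_idem)
  also have "\<dots> \<simeq> (tree_word c @ [c]) @ (r # d # rev (tree_word d))"
    using PD_proj[OF rP] by (intro pg_append pg_refl pg_idem)
  finally show ?thesis by (simp add: r_def c_def d_def)
qed

text \<open>Tree relations hold by \<open>tree_word_edge\<close>, star relations as equalities of
  words, squares by \<open>pg_singular_square\<close>, and cancellation because inverting a letter
  reverses its lift.\<close>

lemma lift_word_rel:
  assumes "(g, h) \<in> subgroup_rels S D T \<union> cancellation_rels E"
  shows "lift_word g \<simeq> lift_word h"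
  using assms
proof (cases rule: grp_rels_cases)
  case (tree e)
  have eE: "e \<in> E" using tree T_E by auto
  let ?r = "e \<cdot> star S e" and ?c = "star S e \<cdot> e"
  note ep = E_proj[OF eE]
  have "lift_word g \<simeq> lift_letter (e, True)" using lift_word_singleton[OF eE] tree by simp
  also have "\<dots> = (tree_word ?r @ [?r]) @ [?c] @ rev (tree_word ?c)" by (simp add: lift_letter_True)
  also have "\<dots> \<simeq> tree_word ?r @ [?c] @ rev (tree_word ?c)"
    by (intro pg_append pg_refl arrow_absorb(2)[OF tree_word_arrow[OF ep(1)]])
  also have "\<dots> = (tree_word ?r @ [?c]) @ rev (tree_word ?c)" by simp
  also have "\<dots> \<simeq> tree_word ?c @ rev (tree_word ?c)"
    by (intro pg_append pg_refl tree_word_edge tree)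
  also have "\<dots> \<simeq> [p0]" by (rule arrowD(5)[OF tree_word_arrow[OF ep(2)]])
  finally show ?thesis using tree by simp
next
  case (star e)
  have "lift_letter (e, True) = lift_letter (star S e, False)"
    using E_proj(4)[OF star(1)] by (simp add: lift_letter_True lift_letter_False star_star)
  then show ?thesis using star by (simp add: pg_refl)
next
  case (square e f e' f')
  have eqs: "e \<cdot> star S e = f \<cdot> star S f" "e' \<cdot> star S e' = f' \<cdot> star S f'"
    "star S e \<cdot> e = star S e' \<cdot> e'" "star S f \<cdot> f = star S f' \<cdot> f'"
    using square(1) by (auto simp: singular_square_def is_square_def greenR_iff greenL_iff)
  have "lift_word g \<simeq> tree_word (star S e \<cdot> e) @ [star S e \<cdot> e, e \<cdot> star S e, star S f \<cdot> f] @ rev (tree_word (star S f \<cdot> f))"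
    using lift_letter_False_True[OF square(2,3) eqs(1)] square(6) by simp
  also have "\<dots> \<simeq> tree_word (star S e \<cdot> e) @ [star S e' \<cdot> e', e' \<cdot> star S e', star S f' \<cdot> f'] @ rev (tree_word (star S f \<cdot> f))"
    by (rule pg_context[OF pg_singular_square[OF square(1)]])
  also have "\<dots> = tree_word (star S e' \<cdot> e') @ [star S e' \<cdot> e', e' \<cdot> star S e', star S f' \<cdot> f'] @ rev (tree_word (star S f' \<cdot> f'))"
    by (simp only: eqs)
  also have "\<dots> \<simeq> lift_word h"
    using pg_sym[OF lift_letter_False_True[OF square(4,5) eqs(2)]] square(7) by simp
  finally show ?thesis .
next
  case (cancel e b)
  have rev: "lift_letter (e, \<not> b) = rev (lift_letter (e, b))"
    by (cases b) (simp_all add: lift_letter_True lift_letter_False)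
  note arr = lift_letter_arrow[OF cancel(1), of b]
  have "lift_word g = lift_letter (e, b) @ (rev (lift_letter (e, b)) @ [p0])" using cancel rev by simp
  also have "\<dots> \<simeq> lift_letter (e, b) @ rev (lift_letter (e, b))"
    by (intro pg_append pg_refl arrow_absorb(2)[OF arrow_rev[OF arr]])
  also have "\<dots> \<simeq> [p0]" by (rule arrowD(5)[OF arr])
  finally show ?thesis using cancel by simp
qed

lemma lift_word_cong:
  assumes "g \<approx> h" "g \<in> lists (E \<times> UNIV)"
  shows "lift_word g \<simeq> lift_word h"
  using assms unfolding grp_eq_def
proof induction
  case (rel u v x y)
  then have l: "u \<in> lists (E \<times> UNIV)" "y \<in> lists (E \<times> UNIV)" by auto
  then have l': "v \<in> lists (E \<times> UNIV)" using grp_lists[OF grp_base[OF rel(1)]] by blast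
  have "lift_word (x @ u @ y) \<simeq> lift_word x @ lift_word (u @ y)"
    using l by (intro lift_word_append) auto
  also have "\<dots> \<simeq> lift_word x @ (lift_word u @ lift_word y)"
    using l by (intro pg_append pg_refl lift_word_append)
  also have "\<dots> \<simeq> lift_word x @ (lift_word v @ lift_word y)"
    by (intro pg_append pg_refl lift_word_rel[OF rel(1)])
  also have "\<dots> \<simeq> lift_word x @ lift_word (v @ y)"
    using l by (intro pg_append pg_refl pg_sym[OF lift_word_append])
  also have "\<dots> \<simeq> lift_word (x @ v @ y)"
    using l l' by (intro pg_sym[OF lift_word_append]) auto
  finally show ?case .
next
  case (sym g h)
  then show ?case using grp_lists[of g h] pg_sym unfolding grp_eq_def by blast
next
  case (trans g h k)
  then show ?case using grp_lists[of g h] pg_trans unfolding grp_eq_def by blast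
qed (rule pg_refl)

section \<open>The labelling and the lifting are mutually inverse\<close>

lemma lift_labels:
  assumes "s \<in> PD" "w \<in> lists (projections S)" "stays s w"
  shows "lift_word (labels s w) \<simeq> tree_word s @ w @ rev (tree_word (act s w))"
  using assms
proof (induction w arbitrary: s)
  case Nil
  then show ?case using pg_sym[OF arrowD(5)[OF tree_word_arrow]] by simp
next
  case (Cons p w)
  have sS: "s \<in> projections S" and p: "p \<in> projections S" and w: "w \<in> lists (projections S)"
    and sps: "s \<cdot> (p \<cdot> s) = s" and st: "stays (p \<cdot> (s \<cdot> p)) w"
    using Cons.prems PD_proj by auto
  define t where "t = p \<cdot> (s \<cdot> p)"
  have t: "t \<in> PD" unfolding t_def by (rule conj_PD[OF Cons.prems(1) p sps])
  have fr: "friendly s t" "s \<cdot> t = s \<cdot> p" using friendly_conj[OF sS p sps] by (simp_all add: t_def)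
  let ?z = "rev (tree_word (act t w))"
  note ta = tree_word_arrow[OF t] and sa = tree_word_arrow[OF Cons.prems(1)]
  have "lift_word (labels s (p # w)) = lift_letter (s \<cdot> t, True) @ lift_word (labels t w)"
    using fr by (simp add: t_def)
  also have "lift_letter (s \<cdot> t, True) = tree_word s @ [s, t] @ rev (tree_word t)"
    using friendly_prod[OF fr(1)] by (simp add: lift_letter_True)
  also have "(tree_word s @ [s, t] @ rev (tree_word t)) @ lift_word (labels t w) \<simeq>
      (tree_word s @ [s, t] @ rev (tree_word t)) @ (tree_word t @ w @ ?z)"
    using Cons.IH[OF t w] st by (intro pg_append pg_refl) (simp add: t_def)
  \<comment> \<open>Tree segments of consecutive letters cancel, so only the two outer ones
    survive.\<close>
  also have "\<dots> = (tree_word s @ [s, t]) @ (rev (tree_word t) @ tree_word t) @ (w @ ?z)" by simp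
  also have "\<dots> \<simeq> (tree_word s @ [s, t]) @ [t] @ (w @ ?z)"
    by (rule pg_context[OF arrowD(6)[OF ta]])
  also have "\<dots> = tree_word s @ ([s, t] @ [t]) @ (w @ ?z)" by simp
  also have "\<dots> \<simeq> tree_word s @ [s, t] @ (w @ ?z)"
    by (rule pg_context[OF arrow_absorb(2)[OF arrow_friendly[OF fr(1)]]])
  \<comment> \<open>To recover the letter \<open>p\<close>, \<open>t\<close> is expanded to
    \<open>p s p\<close>, and \<open>s p s p\<close> contracts.\<close>
  also have "\<dots> = (tree_word s @ [s]) @ [t] @ (w @ ?z)" by simp
  also have "\<dots> \<simeq> (tree_word s @ [s]) @ [p, s, p] @ (w @ ?z)"
    using pg_sym[OF pg_conj[OF p sS, of "[]"]] by (intro pg_append pg_refl) (simp add: t_def)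
  also have "\<dots> = tree_word s @ [s, p, s, p] @ (w @ ?z)" by simp
  also have "\<dots> \<simeq> tree_word s @ [s, p] @ (w @ ?z)"
    using pg_square[OF sS p, of "[]"] by (intro pg_append pg_refl) simp
  also have "\<dots> = (tree_word s @ [s]) @ ([p] @ w @ ?z)" by simp
  also have "\<dots> \<simeq> tree_word s @ ([p] @ w @ ?z)"
    by (intro pg_append arrow_absorb(2)[OF sa] pg_refl)
  finally show ?case by (simp add: t_def)
qed

lemma labels_lift_letter:
  assumes "e \<in> E"
  shows "labels p0 (lift_letter (e, b)) \<approx> [(e, b)]"
proof -
  have *: "labels p0 (tree_word s @ [s, t] @ rev (tree_word t)) \<approx> [(s \<cdot> t, True)]"
    if s: "s \<in> PD" and fr: "friendly s t" for s t
  proof -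
    have t: "t \<in> PD" using friendly_D(1)[OF fr s] .
    note sa = tree_word_arrow[OF s] and ta = tree_word_arrow[OF t]
    have sS: "s \<cdot> s = s" "s \<cdot> (s \<cdot> s) = s" and tst: "t \<cdot> (s \<cdot> t) = t"
      using PD_proj[OF s] friendlyD[OF fr] projD(2) by auto
    \<comment> \<open>Read from \<open>s\<close>, the word \<open>[s, t]\<close> yields a label
      \<open>s\<close> before the wanted \<open>s \<cdot> t\<close>; it is trivial as
      \<open>s\<close> lies in \<open>T\<close>.\<close>
    have "labels p0 (tree_word s @ [s, t] @ rev (tree_word t)) =
        labels p0 (tree_word s) @ [(s, True)] @ [(s \<cdot> t, True)] @ labels t (rev (tree_word t))"
      using arrow_stays(2)[OF sa] sS tst by (simp add: labels_append)
    also have "\<dots> \<approx> [] @ [] @ [(s \<cdot> t, True)] @ []"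
      by (intro grp_append grp_refl tree_word_labels[OF s] grp_tree[OF PD_T[OF s]]
          labels_rev_trivial[OF ta p0_PD tree_word_labels[OF t]])
    finally show ?thesis by simp
  qed
  note ep = E_proj[OF assms]
  show ?thesis
  proof (cases b)
    case True
    then show ?thesis using *[OF ep(1) ep(5)] ep(6) by (simp add: lift_letter_True)
  next
    case False
    have "labels p0 (lift_letter (e, False)) \<approx> [(star S e \<cdot> e \<cdot> (e \<cdot> star S e), True)]"
      using *[OF ep(2) friendly_sym[OF ep(5)]] by (simp add: lift_letter_False)
    also have "star S e \<cdot> e \<cdot> (e \<cdot> star S e) = star S e"
      using E_proj(6)[OF ep(3)] ep(4) by (simp add: star_star)
    also have "[(star S e, True)] \<approx> [(e, False)]" by (rule grp_sym[OF grp_star'[OF assms]])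
    finally show ?thesis using False by simp
  qed
qed

lemma labels_lift_word:
  "g \<in> lists (E \<times> UNIV) \<Longrightarrow> labels p0 (lift_word g) \<approx> g"
proof (induction g)
  case Nil
  then show ?case using grp_tree[OF PD_T[OF p0_PD]] projD(2)[OF p0] by simp
next
  case (Cons x g)
  obtain e b where x: "x = (e, b)" by (cases x)
  then have e: "e \<in> E" and g: "g \<in> lists (E \<times> UNIV)" using Cons.prems by auto
  have "labels p0 (lift_word (x # g)) = labels p0 (lift_letter (e, b)) @ labels p0 (lift_word g)"
    using arrow_stays(2)[OF lift_letter_arrow[OF e]] x by (simp add: labels_append)
  also have "\<dots> \<approx> [(e, b)] @ g" by (intro grp_append labels_lift_letter[OF e] Cons.IH[OF g])
  finally show ?case using x by simp
qed

section \<open>The maximal subgroup\<close>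

definition pg_class :: "'a list \<Rightarrow> 'a list set" where
  "pg_class w = word_cong (PG_rels P) `` {w}"

lemma pg_class_eq_iff: "pg_class u = pg_class v \<longleftrightarrow> u \<simeq> v"
  by (simp add: word_cong_class_eq_iff pg_eq_def pg_class_def)

lemma sprod_PG: "pg_class u \<cdot>\<^bsub>PG P\<^esub> pg_class v = pg_class (u @ v)"
  by (simp add: PG_def semigroup_presentation_def class_prod_class pg_class_def)

lemma carrier_PG: "carrier (PG P) = pg_class ` (lists (projections S) - {[]})"
  by (auto simp: PG_def semigroup_presentation_def carrier_P quotient_def pg_class_def)

lemma pg_class_carrier_iff:
  "pg_class w \<in> carrier (PG P) \<longleftrightarrow> w \<in> lists (projections S) \<and> w \<noteq> []"
proof
  assume "pg_class w \<in> carrier (PG P)"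
  then obtain v where "v \<in> lists (projections S)" "v \<noteq> []" "w \<simeq> v"
    unfolding carrier_PG using pg_class_eq_iff by blast
  then show "w \<in> lists (projections S) \<and> w \<noteq> []" using pg_lists pg_Nil_iff by blast
qed (auto simp: carrier_PG)

section \<open>The \<H>-class of the generator for \<open>p0\<close>\<close>

lemma right_ideal_PG:
  "right_ideal (PG P) (pg_class w) = {pg_class (w @ v) |v. v \<in> lists (projections S)}"
proof -
  have "right_ideal (PG P) (pg_class w) =
      insert (pg_class (w @ [])) {pg_class (w @ v) |v. v \<in> lists (projections S) - {[]}}"
    unfolding right_ideal_def carrier_PG by (auto simp: Setcompr_eq_image image_image sprod_PG)
  then show ?thesis by blast
qed

lemma left_ideal_PG:
  "left_ideal (PG P) (pg_class w) = {pg_class (v @ w) |v. v \<in> lists (projections S)}"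
proof -
  have "left_ideal (PG P) (pg_class w) =
      insert (pg_class ([] @ w)) {pg_class (v @ w) |v. v \<in> lists (projections S) - {[]}}"
    unfolding left_ideal_def carrier_PG by (auto simp: Setcompr_eq_image image_image sprod_PG)
  then show ?thesis by blast
qed

text \<open>If \<open>r\<close> is the letter equivalent to \<open>w @ rev w\<close>, the hypotheses
  give \<open>p0 r = r\<close> and \<open>r p0 = p0\<close> in PG(P). Reversing the first gives
  \<open>r p0 = r\<close>, so the letters agree.\<close>

lemma append_rev_of_right_ideal:
  assumes w: "w \<in> lists (projections S)" "w \<noteq> []" and v: "w @ v \<simeq> [p0]" and absorb: "p0 # w \<simeq> w"
  shows "w @ rev w \<simeq> [p0]"
proof -
  obtain r where r: "r \<in> projections S" "w @ rev w \<simeq> [r]" using append_rev_proj[OF w] .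
  have "[r] @ w \<simeq> (w @ rev w) @ w" by (intro pg_append pg_sym[OF r(2)] pg_refl)
  also have "\<dots> \<simeq> w" using pg_regular[OF w(1)] by simp
  finally have rw: "[r] @ w \<simeq> w" .
  have "[p0] @ [r] \<simeq> [p0] @ (w @ rev w)" by (intro pg_append pg_refl pg_sym[OF r(2)])
  also have "\<dots> \<simeq> w @ rev w" using pg_append[OF absorb pg_refl] by simp
  also have "\<dots> \<simeq> [r]" by (rule r(2))
  finally have 1: "[p0, r] \<simeq> [r]" by simp
  have "[r] @ [p0] \<simeq> [r] @ (w @ v)" by (intro pg_append pg_refl pg_sym[OF v])
  also have "\<dots> \<simeq> w @ v" using pg_append[OF rw pg_refl[of v]] by simp
  also have "\<dots> \<simeq> [p0]" by (rule v)
  finally have "[r, p0] \<simeq> [p0]" by simp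
  moreover have "[r, p0] \<simeq> [r]" using pg_rev[OF 1] by simp
  ultimately have "[r] \<simeq> [p0]" using pg_sym pg_trans by blast
  with r(2) show ?thesis by (rule pg_trans)
qed

text \<open>This identifies the \<H>-class with the vertex group of the groupoid at
  \<open>p0\<close>.\<close>

lemma greenH_PG:
  "(pg_class [p0], X) \<in> greenH (PG P) \<longleftrightarrow> (\<exists>w. X = pg_class w \<and> arrow p0 w p0)"
proof
  assume H: "(pg_class [p0], X) \<in> greenH (PG P)"
  then have "X \<in> carrier (PG P)" by (auto simp: greenH_def greenR_def)
  then obtain w where X: "X = pg_class w" and w: "w \<in> lists (projections S)" "w \<noteq> []"
    unfolding carrier_PG by auto
  have R: "right_ideal (PG P) (pg_class [p0]) = right_ideal (PG P) (pg_class w)"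
    and L: "left_ideal (PG P) (pg_class [p0]) = left_ideal (PG P) (pg_class w)"
    using H by (auto simp: greenH_def greenR_def greenL_def X)
  have selfR: "pg_class u \<in> right_ideal (PG P) (pg_class u)"
    and selfL: "pg_class u \<in> left_ideal (PG P) (pg_class u)" for u
    by (simp_all add: right_ideal_def left_ideal_def)
  obtain v where v: "w @ v \<simeq> [p0]"
    using selfR[of "[p0]"] unfolding R unfolding right_ideal_PG using pg_class_eq_iff pg_sym by blast
  obtain v' where v': "v' @ w \<simeq> [p0]"
    using selfL[of "[p0]"] unfolding L unfolding left_ideal_PG using pg_class_eq_iff pg_sym by blast
  obtain a where a: "w \<simeq> [p0] @ a"
    using selfR[of w] unfolding R[symmetric] unfolding right_ideal_PG using pg_class_eq_iff by blast
  obtain b where b: "w \<simeq> b @ [p0]"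
    using selfL[of w] unfolding L[symmetric] unfolding left_ideal_PG using pg_class_eq_iff by blast
  have absorb: "p0 # z \<simeq> z" if z: "z \<simeq> [p0] @ c" for z c
  proof -
    have "p0 # z \<simeq> p0 # p0 # c" using pg_Cons[OF z] by simp
    also have "\<dots> \<simeq> [p0] @ c" using pg_idem[OF p0] by simp
    also have "\<dots> \<simeq> z" by (rule pg_sym[OF z])
    finally show ?thesis .
  qed
  have "w @ rev w \<simeq> [p0]" using append_rev_of_right_ideal[OF w v absorb[OF a]] .
  \<comment> \<open>The \<L>-half is the \<R>-half for the reversed word.\<close>
  moreover have "rev w @ rev (rev w) \<simeq> [p0]"
  proof (rule append_rev_of_right_ideal)
    show "rev w \<in> lists (projections S)" "rev w \<noteq> []" using w by simp_all
    show "rev w @ rev v' \<simeq> [p0]" using pg_rev[OF v'] by simp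
    show "p0 # rev w \<simeq> rev w" using absorb[of "rev w" "rev b"] pg_rev[OF b] by simp
  qed
  ultimately have "arrow p0 w p0" using w p0 by (simp add: arrow_def)
  then show "\<exists>w. X = pg_class w \<and> arrow p0 w p0" using X by blast
next
  assume "\<exists>w. X = pg_class w \<and> arrow p0 w p0"
  then obtain w where X: "X = pg_class w" and arr: "arrow p0 w p0" by blast
  note a = arrowD[OF arr]
  have subR: "right_ideal (PG P) (pg_class x) \<subseteq> right_ideal (PG P) (pg_class y)"
    if "x \<simeq> y @ z" "z \<in> lists (projections S)" for x y z
  proof -
    have "pg_class (x @ v) = pg_class (y @ (z @ v))" for v
      unfolding pg_class_eq_iff using pg_append[OF that(1) pg_refl[of v]] by simp
    then show ?thesis using that(2) unfolding right_ideal_PG by fastforce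
  qed
  have subL: "left_ideal (PG P) (pg_class x) \<subseteq> left_ideal (PG P) (pg_class y)"
    if "x \<simeq> z @ y" "z \<in> lists (projections S)" for x y z
  proof -
    have "pg_class (v @ x) = pg_class ((v @ z) @ y)" for v
      unfolding pg_class_eq_iff using pg_append[OF pg_refl[of v] that(1)] by simp
    then show ?thesis using that(2) unfolding left_ideal_PG by fastforce
  qed
  have "right_ideal (PG P) (pg_class [p0]) = right_ideal (PG P) (pg_class w)"
    using subR[OF pg_sym[OF a(5)]] subR[of w "[p0]" w] pg_sym[OF arrow_absorb(1)[OF arr]] a(3)
    by auto
  moreover have "left_ideal (PG P) (pg_class [p0]) = left_ideal (PG P) (pg_class w)"
    using subL[OF pg_sym[OF a(6)]] subL[of w w "[p0]"] pg_sym[OF arrow_absorb(2)[OF arr]] a(3)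
    by auto
  ultimately show "(pg_class [p0], X) \<in> greenH (PG P)"
    using a p0 by (auto simp: X greenH_def greenR_def greenL_def pg_class_carrier_iff)
qed

definition grp_class :: "('a \<times> bool) list \<Rightarrow> ('a \<times> bool) list set" where
  "grp_class g = word_cong (subgroup_rels S D T \<union> cancellation_rels E) `` {g}"

lemma grp_class_eq_iff: "grp_class g = grp_class h \<longleftrightarrow> g \<approx> h"
  by (simp add: word_cong_class_eq_iff grp_eq_def grp_class_def)

lemma maximal_subgroup_iso:
  "maximal_subgroup (PG P) (PG_gen P p0) \<cong> group_presentation E (subgroup_rels S D T)"
proof -
  let ?G = "maximal_subgroup (PG P) (PG_gen P p0)" and ?K = "group_presentation E (subgroup_rels S D T)"
  have carrier_G: "carrier ?G = {pg_class w |w. arrow p0 w p0}"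
    using greenH_PG by (auto simp: maximal_subgroup_def PG_gen_def pg_class_def[symmetric])
  have carrier_K: "carrier ?K = grp_class ` lists (E \<times> UNIV)"
    by (auto simp: group_presentation_def quotient_def grp_class_def Let_def)
  have mult_G: "pg_class u \<otimes>\<^bsub>?G\<^esub> pg_class v = pg_class (u @ v)" for u v
    by (simp add: maximal_subgroup_def sprod_PG)
  have mult_K: "grp_class g \<otimes>\<^bsub>?K\<^esub> grp_class h = grp_class (g @ h)" for g h
    by (simp add: group_presentation_def class_prod_class grp_class_def Let_def)
  \<comment> \<open>Any representative will do, by \<open>labels_cong\<close>.\<close>
  define \<phi> where "\<phi> X = grp_class (labels p0 (SOME w. w \<in> X))" for X
  have \<phi>: "\<phi> (pg_class w) = grp_class (labels p0 w)" if w: "arrow p0 w p0" for w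
  proof -
    have "w \<in> pg_class w" by (auto simp: pg_class_def intro: word_cong.refl)
    then have "(SOME v. v \<in> pg_class w) \<in> pg_class w" by (rule someI)
    then have "w \<simeq> (SOME v. v \<in> pg_class w)" by (simp add: pg_eq_def pg_class_def)
    then have "labels p0 w \<approx> labels p0 (SOME v. v \<in> pg_class w)"
      using labels_cong[OF _ p0_PD] arrowD(3)[OF w] arrow_stays(1)[OF w] by blast
    then show ?thesis unfolding \<phi>_def grp_class_eq_iff by (rule grp_sym)
  qed
  have labels: "labels p0 w \<in> lists (E \<times> UNIV)" if w: "arrow p0 w p0" for w
    using labels_lists[OF p0_PD arrowD(3)[OF w] arrow_stays(1)[OF w]] .
  have "\<phi> \<in> hom ?G ?K"
  proof (rule homI)
    fix X assume "X \<in> carrier ?G"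
    then show "\<phi> X \<in> carrier ?K" unfolding carrier_G carrier_K using \<phi> labels by blast
  next
    fix X Y assume "X \<in> carrier ?G" "Y \<in> carrier ?G"
    then obtain u v where uv: "X = pg_class u" "arrow p0 u p0" "Y = pg_class v" "arrow p0 v p0"
      unfolding carrier_G by blast
    \<comment> \<open>The loop \<open>u\<close> ends at \<open>p0\<close>, so the labels of
      \<open>v\<close> are again read from \<open>p0\<close>.\<close>
    then show "\<phi> (X \<otimes>\<^bsub>?G\<^esub> Y) = \<phi> X \<otimes>\<^bsub>?K\<^esub> \<phi> Y"
      using \<phi>[OF arrow_append[OF uv(2,4)]] arrow_stays(2)[OF uv(2)]
      by (simp only: mult_G mult_K \<phi> labels_append)
  qed
  moreover have "bij_betw \<phi> (carrier ?G) (carrier ?K)"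
    unfolding bij_betw_def
  proof
    \<comment> \<open>Lifting the labels back gives injectivity; surjectivity comes from
      \<open>labels_lift_word\<close>.\<close>
    have lift: "lift_word (labels p0 w) \<simeq> w" if w: "arrow p0 w p0" for w
    proof -
      have "lift_word (labels p0 w) \<simeq> [p0] @ (w @ [p0])"
        using lift_labels[OF p0_PD arrowD(3)[OF w] arrow_stays(1)[OF w]]
        by (simp add: arrow_stays(2)[OF w] tree_word_root)
      also have "\<dots> \<simeq> [p0] @ w" by (intro pg_append pg_refl arrow_absorb(2)[OF w])
      also have "\<dots> \<simeq> w" using arrow_absorb(1)[OF w] by simp
      finally show ?thesis .
    qed
    show "inj_on \<phi> (carrier ?G)"
    proof (rule inj_onI)
      fix X Y assume "X \<in> carrier ?G" "Y \<in> carrier ?G" and eq: "\<phi> X = \<phi> Y"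
      then obtain u v where uv: "X = pg_class u" "arrow p0 u p0" "Y = pg_class v" "arrow p0 v p0"
        unfolding carrier_G by blast
      then have "labels p0 u \<approx> labels p0 v" using eq \<phi> grp_class_eq_iff by simp
      then have "lift_word (labels p0 u) \<simeq> lift_word (labels p0 v)"
        using lift_word_cong labels[OF uv(2)] by blast
      then have "u \<simeq> v" using lift uv pg_sym pg_trans by meson
      then show "X = Y" using uv pg_class_eq_iff by simp
    qed
    show "\<phi> ` carrier ?G = carrier ?K"
    proof
      show "\<phi> ` carrier ?G \<subseteq> carrier ?K" unfolding carrier_G carrier_K using \<phi> labels by auto
      show "carrier ?K \<subseteq> \<phi> ` carrier ?G"
      proof
        fix Z assume "Z \<in> carrier ?K"
        then obtain g where g: "Z = grp_class g" "g \<in> lists (E \<times> UNIV)" unfolding carrier_K by blast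
        note arr = lift_word_arrow[OF g(2)]
        have "\<phi> (pg_class (lift_word g)) = Z"
          using \<phi>[OF arr] labels_lift_word[OF g(2)] grp_class_eq_iff g(1) by simp
        then show "Z \<in> \<phi> ` carrier ?G" unfolding carrier_G using arr by blast
      qed
    qed
  qed
  ultimately show ?thesis unfolding is_iso_def iso_def by blast
qed

end

theorem corollary7p22:
  fixes S :: "'a star_sgrp" and P :: "'a proj_alg"
    and p0 :: 'a and D E_D T :: "'a set"
  assumes "regular_star_semigroup S"
    and "projection_generated S"
    and "is_projection_algebra_of P S"
    and "p0 \<in> carrier P"
    and "D = greenD S `` {p0}"
    and "E_D = idempotents S \<inter> D"
    and "GH_spanning_tree S D T"
    and "carrier P \<inter> D \<subseteq> T"
  shows "maximal_subgroup (PG P) (PG_gen P p0) \<cong> group_presentation E_D (subgroup_rels S D T)"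
proof -
  have "carrier P = projections S"
    using assms(3) by (simp add: is_projection_algebra_of_def)
  then interpret subgroup_presentation S P p0 D T
    using assms
    by (intro subgroup_presentation.intro projection_presentation.intro
        projection_presentation_axioms.intro subgroup_presentation_axioms.intro) simp_all
  show ?thesis using maximal_subgroup_iso assms(6) by (simp add: E_def)
qed

end
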